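(* Let $X\in\mathbb{R}^{m\times n}$ be a tall-skinny matrix of full column rank and let $\hat Q,\hat R$ be the factors computed by $[\hat Q,\hat R]=\mathrm{RCLUPPr}(X)$ in floating-point arithmetic with a single unit roundoff $\mathbf u=\mathbf u_b$ and sketch matrix $\Omega$, under the rounding model, the assumption on $\Omega$ and $\epsilon$, and the size restrictions listed in the context. Put $$j=\frac{\frac{(1-\epsilon)^{1/2}}{(1+\epsilon)^{1/2}}-0.1}{12.8},\qquad k=\frac{1}{\frac{0.8}{(1+\epsilon)^{1/2}}-\frac{0.084}{(1-\epsilon)^{1/2}}},$$ $$\begin{aligned}\Delta_{res}=&\Big[\tfrac{1.31}{(1-\epsilon)^{1/2}}+\tfrac{1.37}{(1-\epsilon)^{1/2}}\sqrt{1+1.03j^2}+\tfrac{1.37}{(1-\epsilon)^{1/2}}\sqrt{1+6j^2}\,(1+1.03j^2)\Big]\,k\,n\sqrt n\,\mathbf u_b\|X\|_F\\&+\Big[\tfrac{1.36}{(1-\epsilon)^{1/2}}\sqrt{1+1.03j^2}+\tfrac{1.37}{(1-\epsilon)^{1/2}}\sqrt{1+6j^2}\,(1+1.03j^2)\Big]\,k\,n^2\mathbf u_b\|X\|_2 .\end{aligned}$$ Then, with probability at least $(1-p)^2$, both $$\|\hat Q^\top\hat Q-I_n\|_F\le 6\big(mn\mathbf u_b+n(n+1)\mathbf u_b\big)\qquad\text{and}\qquad\|\hat Q\hat R-X\|_F\le\Delta_{res}.$$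
   Context: Notation: $\|\cdot\|_2$, $\|\cdot\|_F$ are the spectral and Frobenius norms; $\sigma_i(A)$ is the $i$-th largest singular value; $\kappa_2(A)=\|A\|_2/\sigma_n(A)$ for a matrix with $n$ columns; $|A|$ is the entrywise absolute value, and inequalities between matrices are entrywise. Hats denote computed quantities. For positive $k$, $\gamma_k=\frac{k\mathbf u_b}{1-k\mathbf u_b}$; throughout it is assumed that $\gamma_k\le1.02k\mathbf u_b$ for all $k$ occurring. Dimensions: $X\in\mathbb{R}^{m\times n}$ has full column rank, $m>n$, and $\Omega\in\mathbb{R}^{s\times m}$ with $n\le s\le m$. Sketching: $\Omega$ is a random matrix. For $0\le\epsilon<1$, a matrix $\Omega$ is an $\epsilon$-subspace embedding for a subspace $\mathcal K\subset\mathbb{R}^m$ if $|\langle x,y\rangle-\langle\Omega x,\Omega y\rangle|\le\epsilon\|x\|_2\|y\|_2$ for all $x,y\in\mathcal K$. A random $\Omega$ is an $(\epsilon,p,n)$ oblivious $l_2$-subspace embedding if for every fixed $n$-dimensional subspace $\mathcal K\subset\mathbb{R}^m$ it is an $\epsilon$-subspace embedding for $\mathcal K$ with probability at least $1-p$. Algorithm RCLUPPr (exact form): $LU=PX$ (LU with partial pivoting), $L_s=\Omega L$, $HY_0=L_s$ (thin Householder QR), $Y_1=Y_0U$, $W=XY_1^{-1}$, then CholeskyQR2 on $W$ giving $W=QZ$, and $R=ZY_1$. CholeskyQR of a matrix $W$ forms $G=W^\top W$, its Cholesky factor $R$ with $R^\top R=G$, and $Q=WR^{-1}$; CholeskyQR2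 applies CholeskyQR twice. Computed quantities and rounding model; all steps are in unit roundoff $\mathbf u=\mathbf u_b$. (i) $\hat L\hat U=PX+\Delta_{lu}$, $P$ a permutation matrix, $\hat L\in\mathbb{R}^{m\times n}$ unit lower trapezoidal, $\hat U\in\mathbb{R}^{n\times n}$ upper triangular, $|\Delta_{lu}|\le\gamma_n|\hat L||\hat U|$. (ii) $\hat L_s=\Omega\hat L+\Delta_s$, $|\Delta_s|\le\gamma_m|\Omega||\hat L|$. (iii) $\hat H\hat Y_0=\hat L_s+\Delta_h$, $\hat H\in\mathbb{R}^{s\times n}$, $\hat Y_0$ upper triangular, $\|\Delta_h\|_F\le\gamma_{csn}\|\hat L_s\|_F$ with a positive constant $c$, and $\|\hat H^\top\hat H-I_n\|_F=\mathcal O(\mathbf u_b)$, taken to be at most $0.01$. (iv) $\hat Y_1=\hat Y_0\hat U+\Delta_y$, $|\Delta_y|\le\gamma_n|\hat Y_0||\hat U|$. (v) $\hat W\hat Y_1=X+\Delta_x$, where the rows satisfy $\hat w_i(\hat Y_1+\Delta\hat Y_1^{(i)})=x_i$ with $|\Delta\hat Y_1^{(i)}|\le\gamma_n|\hat Y_1|$. (vi) CholeskyQR2 and assembly of $R$: $\hat G_1=\hat W^\top\hat W+\Delta_1$, $\hat Y_2^\top\hat Y_2=\hat G_1+\Delta_2$, $\hat V\hat Y_2=\hat W+\Delta_3$, $\hat Y_3=\hat Y_2\hat Y_1+\Delta_4$, $\hat G_2=\hat V^\top\hat V+\Delta_5$, $\hat Y_4^\top\hat Y_4=\hat G_2+\Delta_6$,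 $\hat Q\hat Y_4=\hat V+\Delta_7$, $\hat R=\hat Y_4\hat Y_3+\Delta_8$. The standard componentwise floating-point bounds apply: matrix products, $|\Delta_1|\le\gamma_m|\hat W|^\top|\hat W|$, $|\Delta_5|\le\gamma_m|\hat V|^\top|\hat V|$, $|\Delta_4|\le\gamma_n|\hat Y_2||\hat Y_1|$, $|\Delta_8|\le\gamma_n|\hat Y_4||\hat Y_3|$; Cholesky factorizations, $|\Delta_2|\le\gamma_{n+1}|\hat Y_2|^\top|\hat Y_2|$, $|\Delta_6|\le\gamma_{n+1}|\hat Y_4|^\top|\hat Y_4|$; row-wise triangular solves for $\hat V$ and $\hat Q$ (each row solves a system with coefficient matrix $\hat Y_2+\Delta\hat Y_2^{(i)}$, resp. $\hat Y_4+\Delta\hat Y_4^{(i)}$, with $|\Delta\hat Y_2^{(i)}|\le\gamma_n|\hat Y_2|$, resp. $|\Delta\hat Y_4^{(i)}|\le\gamma_n|\hat Y_4|$). Assumption on $\Omega$ and $\epsilon$: $\Omega$ is an $(\epsilon,p,n)$ oblivious $l_2$-subspace embedding and $\epsilon<\frac{1-\eta^2}{1+\eta^2}$, where $\eta=\max\{12.8\sqrt{mn\mathbf u+n(n+1)\mathbf u}+0.1,\ 10.44n\sqrt n\,\mathbf u+0.1,\ 0.105\}<1$. Size restrictions: with $c_1=\max(c,1)$, $t=1.02\,m\mathbf u_b\sqrt n\,\|\Omega\|_F$, $d=\max(\|\Omega\|_2,1)$, $$m\sqrt s\,\mathbf u_b\le\tfrac1{64},\qquad c_1sn\sqrt n\,\mathbf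 u_b\le\tfrac1{64},$$ $$\kappa_2(\hat L)\le\frac{(1-\epsilon)^{1/2}}{25.5t+25.5csn\sqrt n\,\mathbf u_b((1+\epsilon)^{1/2}+t)},\qquad \kappa_2(\hat L)\kappa_2(\hat U)\le\frac{(1-\epsilon)^{1/2}}{23.6\,d\,n^2\mathbf u_b((1+\epsilon)^{1/2}+t)}.$$ *)

theory Defs
  imports "HOL-Probability.Probability"
begin

text \<open>An \<open>m \<times> n\<close> real matrix is a \<^typ>\<open>real^'n^'m\<close>, with \<open>m = CARD('m)\<close> and \<open>n = CARD('n)\<close>.
  On this type the library \<^const>\<open>norm\<close> is the Frobenius norm, and \<^const>\<open>abs\<close> and
  \<open>\<le>\<close> are entrywise.\<close>

abbreviation frobenius_norm :: "real^'n^'m \<Rightarrow> real" where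
  "frobenius_norm A \<equiv> norm A"

abbreviation spectral_norm :: "real^'n^'m \<Rightarrow> real" where
  "spectral_norm A \<equiv> onorm ((*v) A)"

definition sv_space :: "real^'n^'m \<Rightarrow> real \<Rightarrow> (real^'n) set" where
  "sv_space A \<sigma> = {v. (transpose A ** A) *v v = \<sigma>\<^sup>2 *\<^sub>R v}"

definition singular_values :: "real^'n^'m \<Rightarrow> real set" where
  "singular_values A = {\<sigma>. 0 \<le> \<sigma> \<and> (\<exists>v\<in>sv_space A \<sigma>. v \<noteq> 0)}"

text \<open>The \<open>n\<close> singular values are the square roots of the eigenvalues of \<open>A\<^sup>T A\<close>, repeated
  according to the dimension of the eigenspace. The \<open>i\<close>-th largest one (\<open>1 \<le> i \<le> n\<close>) is the
  largest \<open>\<sigma>\<close> among them such that, with repetitions, at least \<open>i\<close> of them are \<open>\<ge> \<sigma>\<close>.\<close>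

definition singular_value :: "nat \<Rightarrow> real^'n^'m \<Rightarrow> real" where
  "singular_value i A =
     Max {\<sigma> \<in> singular_values A. i \<le> (\<Sum>\<tau> | \<tau> \<in> singular_values A \<and> \<sigma> \<le> \<tau>. dim (sv_space A \<tau>))}"

text \<open>Extended-real valued, so that a bound on the condition number of a matrix with dependent
  columns fails rather than holding through \<open>x / 0 = 0\<close>.\<close>

definition cond2 :: "real^'n^'m \<Rightarrow> ereal" where
  "cond2 A = (if singular_value CARD('n) A = 0 then \<infinity>
              else ereal (spectral_norm A / singular_value CARD('n) A))"

text \<open>Triangular shapes refer to the linear order of the index types; \<open>pos i\<close> is the position
  of \<open>i\<close> counted from 0, which makes row and column indices of different types comparable.\<close>

definition pos :: "'i::{finite,linorder} \<Rightarrow> nat" where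
  "pos i = card {j. j < i}"

definition upper_triangular :: "real^'n::{finite,linorder}^'n::{finite,linorder} \<Rightarrow> bool" where
  "upper_triangular A \<longleftrightarrow> (\<forall>i j. j < i \<longrightarrow> A $ i $ j = 0)"

definition unit_lower_trapezoidal ::
    "real^'n::{finite,linorder}^'m::{finite,linorder} \<Rightarrow> bool" where
  "unit_lower_trapezoidal A \<longleftrightarrow>
     (\<forall>i j. (pos i = pos j \<longrightarrow> A $ i $ j = 1) \<and> (pos i < pos j \<longrightarrow> A $ i $ j = 0))"

definition permutation_matrix :: "real^'m^'m \<Rightarrow> bool" where
  "permutation_matrix P \<longleftrightarrow> (\<exists>\<pi>. bij \<pi> \<and> P = (\<chi> i j. if j = \<pi> i then 1 else 0))"

definition subspace_embedding :: "real \<Rightarrow> real^'m^'s \<Rightarrow> (real^'m) set \<Rightarrow> bool" where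
  "subspace_embedding \<epsilon> Om K \<longleftrightarrow>
     (\<forall>x\<in>K. \<forall>y\<in>K. \<bar>x \<bullet> y - (Om *v x) \<bullet> (Om *v y)\<bar> \<le> \<epsilon> * norm x * norm y)"

definition oblivious_embedding ::
    "'w measure \<Rightarrow> ('w \<Rightarrow> real^'m^'s) \<Rightarrow> real \<Rightarrow> real \<Rightarrow> nat \<Rightarrow> bool" where
  "oblivious_embedding M Om \<epsilon> p n \<longleftrightarrow>
     (\<forall>K. subspace K \<and> dim K = n \<longrightarrow>
        1 - p \<le> measure M {\<omega> \<in> space M. subspace_embedding \<epsilon> (Om \<omega>) K})"

definition gam :: "real \<Rightarrow> real \<Rightarrow> real" where
  "gam u k = k * u / (1 - k * u)"

definition lu_computed ::
    "real \<Rightarrow> real^'n::{finite,linorder}^'m::{finite,linorder} \<Rightarrow> real^'m::{finite,linorder}^'m::{finite,linorder} \<Rightarrow>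
     real^'n::{finite,linorder}^'m::{finite,linorder} \<Rightarrow> real^'n::{finite,linorder}^'n::{finite,linorder} \<Rightarrow> bool" where
  "lu_computed u X P Lh Uh \<longleftrightarrow>
     permutation_matrix P \<and> unit_lower_trapezoidal Lh \<and> upper_triangular Uh \<and>
     (\<exists>D. Lh ** Uh = P ** X + D \<and> \<bar>D\<bar> \<le> gam u (real CARD('n)) *\<^sub>R (\<bar>Lh\<bar> ** \<bar>Uh\<bar>))"

definition product_computed ::
    "real \<Rightarrow> real^'k^'a \<Rightarrow> real^'b^'k \<Rightarrow> real^'b^'a \<Rightarrow> bool" where
  "product_computed u A B C \<longleftrightarrow>
     (\<exists>D. C = A ** B + D \<and> \<bar>D\<bar> \<le> gam u (real CARD('k)) *\<^sub>R (\<bar>A\<bar> ** \<bar>B\<bar>))"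

definition householder_qr_computed ::
    "real \<Rightarrow> real \<Rightarrow> real^'n::{finite,linorder}^'s \<Rightarrow> real^'n::{finite,linorder}^'s \<Rightarrow> real^'n::{finite,linorder}^'n::{finite,linorder} \<Rightarrow> bool" where
  "householder_qr_computed u c A H Y \<longleftrightarrow>
     upper_triangular Y \<and>
     (\<exists>D. H ** Y = A + D \<and>
        frobenius_norm D \<le> gam u (c * real CARD('s) * real CARD('n)) * frobenius_norm A) \<and>
     frobenius_norm (transpose H ** H - mat 1) \<le> 0.01"

text \<open>\<open>W\<close> is the computed solution of \<open>W Y = A\<close>, each row having its own backward error.\<close>

definition row_solve_computed ::
    "real \<Rightarrow> real^'n^'n \<Rightarrow> real^'n^'m \<Rightarrow> real^'n^'m \<Rightarrow> bool" where
  "row_solve_computed u Y A W \<longleftrightarrow>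
     (\<forall>i. \<exists>D. row i W v* (Y + D) = row i A \<and> \<bar>D\<bar> \<le> gam u (real CARD('n)) *\<^sub>R \<bar>Y\<bar>)"

definition cholesky_computed ::
    "real \<Rightarrow> real^'n::{finite,linorder}^'n::{finite,linorder} \<Rightarrow> real^'n::{finite,linorder}^'n::{finite,linorder} \<Rightarrow> bool" where
  "cholesky_computed u G Y \<longleftrightarrow>
     upper_triangular Y \<and>
     (\<exists>D. transpose Y ** Y = G + D \<and>
        \<bar>D\<bar> \<le> gam u (real CARD('n) + 1) *\<^sub>R (transpose \<bar>Y\<bar> ** \<bar>Y\<bar>))"

text \<open>\<open>Qh\<close> and \<open>Rh\<close> are produced by the floating-point run on \<open>X\<close> with sketch matrix \<open>Om\<close>,
  starting from the already computed LU factors \<open>Lh\<close> and \<open>Uh\<close>. The operands of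
  \<^const>\<open>product_computed\<close> and \<^const>\<open>row_solve_computed\<close> come before the result.\<close>

definition rclupp_computed ::
    "real \<Rightarrow> real \<Rightarrow> real^'n::{finite,linorder}^'m \<Rightarrow> real^'n::{finite,linorder}^'m \<Rightarrow> real^'n::{finite,linorder}^'n::{finite,linorder} \<Rightarrow> real^'m^'s \<Rightarrow>
     real^'n::{finite,linorder}^'m \<Rightarrow> real^'n::{finite,linorder}^'n::{finite,linorder} \<Rightarrow> bool" where
  "rclupp_computed u c X Lh Uh Om Qh Rh \<longleftrightarrow>
     (\<exists>Ls H Y0 Y1 W G1 Y2 V Y3 G2 Y4.
        product_computed u Om Lh Ls \<and>
        householder_qr_computed u c Ls H Y0 \<and>
        product_computed u Y0 Uh Y1 \<and>
        row_solve_computed u Y1 X W \<and>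
        product_computed u (transpose W) W G1 \<and>
        cholesky_computed u G1 Y2 \<and>
        row_solve_computed u Y2 W V \<and>
        product_computed u Y2 Y1 Y3 \<and>
        product_computed u (transpose V) V G2 \<and>
        cholesky_computed u G2 Y4 \<and>
        row_solve_computed u Y4 V Qh \<and>
        product_computed u Y4 Y3 Rh)"

definition eta :: "real \<Rightarrow> real \<Rightarrow> real \<Rightarrow> real" where
  "eta u m n = Max {12.8 * sqrt (m * n * u + n * (n + 1) * u) + 0.1,
                    10.44 * n * sqrt n * u + 0.1,
                    0.105}"

definition cond_restrictions ::
    "real \<Rightarrow> real \<Rightarrow> real \<Rightarrow> real^'n^'m \<Rightarrow> real^'n^'n \<Rightarrow> real^'m^'s \<Rightarrow> bool" where
  "cond_restrictions u c \<epsilon> Lh Uh Om \<longleftrightarrow>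
     (let s = real CARD('s); n = real CARD('n);
          t = 1.02 * real CARD('m) * u * sqrt n * frobenius_norm Om;
          d = max (spectral_norm Om) 1
      in cond2 Lh \<le> ereal (sqrt (1 - \<epsilon>) /
             (25.5 * t + 25.5 * c * s * n * sqrt n * u * (sqrt (1 + \<epsilon>) + t))) \<and>
         cond2 Lh * cond2 Uh \<le> ereal (sqrt (1 - \<epsilon>) /
             (23.6 * d * n\<^sup>2 * u * (sqrt (1 + \<epsilon>) + t))))"

definition jcoef :: "real \<Rightarrow> real" where
  "jcoef \<epsilon> = (sqrt (1 - \<epsilon>) / sqrt (1 + \<epsilon>) - 0.1) / 12.8"

definition kcoef :: "real \<Rightarrow> real" where
  "kcoef \<epsilon> = 1 / (0.8 / sqrt (1 + \<epsilon>) - 0.084 / sqrt (1 - \<epsilon>))"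

definition Delta_res :: "real \<Rightarrow> real \<Rightarrow> real^'n^'m \<Rightarrow> real" where
  "Delta_res u \<epsilon> X =
     (let n = real CARD('n); j = jcoef \<epsilon>; k = kcoef \<epsilon>; e = sqrt (1 - \<epsilon>)
      in (1.31 / e + 1.37 / e * sqrt (1 + 1.03 * j\<^sup>2)
            + 1.37 / e * sqrt (1 + 6 * j\<^sup>2) * (1 + 1.03 * j\<^sup>2))
           * k * n * sqrt n * u * frobenius_norm X
       + (1.36 / e * sqrt (1 + 1.03 * j\<^sup>2)
            + 1.37 / e * sqrt (1 + 6 * j\<^sup>2) * (1 + 1.03 * j\<^sup>2))
           * k * n\<^sup>2 * u * spectral_norm X)"

end

theory Submission
  imports Defs
begin

text \<open>Write \<open>a = sqrt (1 - \<epsilon>)\<close> and \<open>b = sqrt (1 + \<epsilon>)\<close>. The embedding property for the fixed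
  \<open>n\<close>-dimensional range of \<open>Lh\<close> gives \<open>a |Lh v| \<le> |Om Lh v| \<le> b |Lh v|\<close>.
  Under the conditioning restrictions every backward error up to the computation of \<open>Y1\<close> is a small
  multiple of \<open>a \<sigma>_min\<close> of the matrix it perturbs, hence pointwise a small relative error. So
  \<open>|Y1 v|\<close> stays within constant multiples of \<open>a |X v|\<close> and \<open>b |X v|\<close>, and the singular values of
  \<open>W\<close> lie in \<open>[0.877 / b - 0.063 / a, 1.21 / a]\<close>. With \<open>\<delta> = mnu + n(n+1)u\<close> the hypothesis on \<open>eta\<close>
  bounds \<open>\<delta> \<kappa>\<^sub>2(W)\<^sup>2\<close> by \<open>1/80\<close>. A Cholesky QR step then yields a factor whose departure from
  orthogonality is at most \<open>3.3 \<delta> \<kappa>\<^sub>2\<^sup>2\<close>; after the first step \<open>\<kappa>\<^sub>2\<close> is close to 1, so the second step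
  gives \<open>6 \<delta>\<close>. The residual splits as \<open>Dx + D3 Y1 + V D4 + D7 Y3 + Q D8\<close>, each term being estimated
  separately.\<close>

text \<open>The constants are written as fractions: \<open>51/50\<close> is the factor \<open>1.02\<close> of the bound on \<open>gam\<close>,
  and \<open>51/2\<close>, \<open>118/5\<close>, \<open>64/5\<close> are \<open>25.5\<close>, \<open>23.6\<close>, \<open>12.8\<close>.\<close>

section \<open>Spectral and Frobenius norms\<close>

lemma matrix_add_rdistrib: "(A + B) ** C = A ** C + B ** (C :: 'a::semiring_1^'n^'k)"
  by (vector matrix_matrix_mult_def sum.distrib[symmetric] field_simps)

lemma matrix_diff_ldistrib: "A ** (B - C) = A ** B - A ** (C :: 'a::ring_1^'n^'k)"
  by (simp add: vec_eq_iff matrix_matrix_mult_def sum_subtractf algebra_simps)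

lemma matrix_diff_rdistrib: "(A - B) ** C = A ** C - B ** (C :: 'a::ring_1^'n^'k)"
  by (simp add: vec_eq_iff matrix_matrix_mult_def sum_subtractf algebra_simps)

lemma norm_mult_vec_le_onorm:
  fixes A :: "real^'n^'m"
  shows "norm (A *v x) \<le> spectral_norm A * norm x"
  by (rule onorm[OF matrix_vector_mul_bounded_linear])

lemma spectral_norm_nonneg: "0 \<le> spectral_norm (A :: real^'n^'m)"
  by (rule onorm_pos_le[OF matrix_vector_mul_bounded_linear])

lemma spectral_norm_leI:
  fixes A :: "real^'n^'m"
  assumes "\<And>x. norm (A *v x) \<le> b * norm x"
  shows "spectral_norm A \<le> b"
  using assms by (rule onorm_le)

lemma norm_matrix_rows: "(norm (A :: real^'n^'m))\<^sup>2 = (\<Sum>i\<in>UNIV. (norm (row i A))\<^sup>2)"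
  by (simp add: norm_vec_def L2_set_def row_def sum_nonneg real_sqrt_pow2)

lemma norm_transpose: "norm (transpose A) = norm (A :: real^'n^'m)"
proof -
  have "(norm (transpose A))\<^sup>2 = (norm A)\<^sup>2"
    unfolding norm_vec_def L2_set_def
    by (simp add: sum_nonneg real_sqrt_pow2 transpose_def) (rule sum.swap)
  then show ?thesis by simp
qed

lemma norm_matrix_columns: "(norm (A :: real^'n^'m))\<^sup>2 = (\<Sum>j\<in>UNIV. (norm (A *v axis j 1))\<^sup>2)"
  using norm_matrix_rows[of "transpose A"]
  by (simp add: norm_transpose row_transpose matrix_vector_mult_basis)

lemma norm_mult_vec_le:
  fixes A :: "real^'n^'m"
  shows "norm (A *v x) \<le> norm A * norm x"
proof -
  have "(norm (A *v x))\<^sup>2 = (\<Sum>i\<in>UNIV. (row i A \<bullet> x)\<^sup>2)"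
    unfolding norm_vec_def[of "A *v x"] L2_set_def
    by (simp add: sum_nonneg real_sqrt_pow2 matrix_vector_mult_def inner_vec_def row_def)
  also have "\<dots> \<le> (\<Sum>i\<in>UNIV. (norm (row i A) * norm x)\<^sup>2)"
    by (intro sum_mono) (metis Cauchy_Schwarz_ineq2 abs_ge_zero power2_abs power_mono)
  also have "\<dots> = (norm A * norm x)\<^sup>2"
    by (simp add: norm_matrix_rows power_mult_distrib sum_distrib_right)
  finally show ?thesis by (simp add: power2_le_iff_abs_le)
qed

lemma spectral_norm_le_norm: "spectral_norm (A :: real^'n^'m) \<le> norm A"
  by (rule spectral_norm_leI) (rule norm_mult_vec_le)

text \<open>The squared Frobenius norm is the sum of the squared lengths of the images of the unit
  vectors, so a pointwise comparison of two operators passes to their Frobenius norms. This is how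
  \<open>norm Y1\<close> is later bounded by \<open>norm X\<close>.\<close>

lemma norm_le_columnwise:
  fixes A :: "real^'n^'m" and B :: "real^'n^'k"
  assumes "\<And>x. norm (A *v x) \<le> b * norm (B *v x)" "0 \<le> b"
  shows "norm A \<le> b * norm B"
proof -
  have "(norm A)\<^sup>2 \<le> (\<Sum>j\<in>UNIV. (b * norm (B *v axis j 1))\<^sup>2)"
    unfolding norm_matrix_columns by (intro sum_mono power_mono assms) auto
  also have "\<dots> = (b * norm B)\<^sup>2"
    by (simp add: norm_matrix_columns power_mult_distrib sum_distrib_left)
  finally show ?thesis using assms by (simp add: power2_le_iff_abs_le)
qed

lemma norm_mat_1: "norm (mat 1 :: real^'n^'n) = sqrt CARD('n)"
proof -
  have "(norm (mat 1 :: real^'n^'n))\<^sup>2 = CARD('n)"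
    by (simp add: norm_matrix_columns)
  then show ?thesis by (metis norm_ge_zero real_sqrt_unique)
qed

lemma norm_le_sqrt_spectral_norm:
  fixes A :: "real^'n^'m"
  shows "norm A \<le> sqrt CARD('n) * spectral_norm A"
  using norm_le_columnwise[of A "spectral_norm A" "mat 1 :: real^'n^'n"] norm_mult_vec_le_onorm[of A]
  by (simp add: spectral_norm_nonneg norm_mat_1 mult.commute)

lemma norm_matrix_mult_le_left:
  fixes A :: "real^'k^'m" and B :: "real^'n^'k"
  shows "norm (A ** B) \<le> spectral_norm A * norm B"
  by (rule norm_le_columnwise)
    (simp_all add: matrix_vector_mul_assoc[symmetric] norm_mult_vec_le_onorm spectral_norm_nonneg)

lemma norm_matrix_mult_le:
  fixes A :: "real^'k^'m" and B :: "real^'n^'k"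
  shows "norm (A ** B) \<le> norm A * norm B"
  using norm_matrix_mult_le_left[of A B] spectral_norm_le_norm[of A]
  by (meson mult_right_mono norm_ge_zero order_trans)

lemma spectral_norm_mult_le:
  fixes A :: "real^'k^'m" and B :: "real^'n^'k"
  shows "spectral_norm (A ** B) \<le> spectral_norm A * spectral_norm B"
proof (rule spectral_norm_leI)
  fix x
  have "norm (A *v (B *v x)) \<le> spectral_norm A * (spectral_norm B * norm x)"
    by (meson norm_mult_vec_le_onorm mult_left_mono order_trans spectral_norm_nonneg)
  then show "norm (A ** B *v x) \<le> spectral_norm A * spectral_norm B * norm x"
    by (simp add: matrix_vector_mul_assoc mult.assoc)
qed

text \<open>Since |A^T x|^2 = <x, A A^T x>, Cauchy-Schwarz gives the bound with one extra factor
  |A^T x|, which cancels unless it is 0.\<close>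

lemma spectral_norm_transpose_le: "spectral_norm (transpose A) \<le> spectral_norm (A :: real^'n^'m)"
proof (rule spectral_norm_leI)
  fix x
  let ?y = "transpose A *v x"
  have "norm ?y * norm ?y = x \<bullet> (A *v ?y)"
    by (metis dot_lmul_matrix transpose_matrix_vector power2_norm_eq_inner power2_eq_square)
  also have "\<dots> \<le> norm x * (spectral_norm A * norm ?y)"
    by (meson norm_cauchy_schwarz norm_mult_vec_le_onorm mult_left_mono norm_ge_zero order_trans)
  finally show "norm ?y \<le> spectral_norm A * norm x"
    by (cases "norm ?y = 0")
      (auto simp: spectral_norm_nonneg mult_ac)
qed

lemma spectral_norm_transpose: "spectral_norm (transpose A) = spectral_norm (A :: real^'n^'m)"
  using spectral_norm_transpose_le[of A] spectral_norm_transpose_le[of "transpose A"] by simp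

lemma norm_matrix_mult_le_right:
  fixes A :: "real^'k^'m" and B :: "real^'n^'k"
  shows "norm (A ** B) \<le> norm A * spectral_norm B"
  using norm_matrix_mult_le_left[of "transpose B" "transpose A"]
  by (metis matrix_transpose_mul norm_transpose spectral_norm_transpose mult.commute)

section \<open>Norm bounds from entrywise error bounds\<close>

lemma norm_abs_matrix: "norm \<bar>A :: real^'n^'m\<bar> = norm A"
  by (simp add: norm_vec_def L2_set_def abs_vec_def)

lemma norm_matrix_mono:
  fixes A B :: "real^'n^'m"
  assumes "\<bar>A\<bar> \<le> B"
  shows "norm A \<le> norm B"
proof -
  have "\<bar>A $ i $ j\<bar> \<le> \<bar>B $ i $ j\<bar>" for i j
    using assms by (auto simp: less_eq_vec_def abs_vec_def intro: order_trans[OF _ abs_ge_self])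
  then have "norm (A $ i) \<le> norm (B $ i)" for i
    by (intro norm_le_componentwise_cart) auto
  then show ?thesis by (rule norm_le_componentwise_cart)
qed

text \<open>Here \<open>g\<close> may have either sign: in the applications it is a value of
  \<open>gam\<close>, known only to lie below a non-negative \<open>h\<close>.\<close>

lemma norm_abs_le_product:
  fixes A :: "real^'k^'m" and B :: "real^'n^'k"
  assumes "\<bar>D\<bar> \<le> g *\<^sub>R (\<bar>A\<bar> ** \<bar>B\<bar>)" "g \<le> h" "0 \<le> h"
  shows "norm D \<le> h * (norm A * norm B)"
proof -
  have "0 \<le> (\<bar>A\<bar> ** \<bar>B\<bar>) $ i $ j" for i j
    by (auto simp: matrix_matrix_mult_def abs_vec_def intro!: sum_nonneg)
  then have "g *\<^sub>R (\<bar>A\<bar> ** \<bar>B\<bar>) \<le> h *\<^sub>R (\<bar>A\<bar> ** \<bar>B\<bar>)"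
    using assms by (auto simp: less_eq_vec_def intro!: mult_right_mono)
  with assms have "norm D \<le> norm (h *\<^sub>R (\<bar>A\<bar> ** \<bar>B\<bar>))"
    by (intro norm_matrix_mono) auto
  also have "\<dots> \<le> h * (norm A * norm B)"
    using norm_matrix_mult_le[of "\<bar>A\<bar>" "\<bar>B\<bar>"] assms
    by (simp add: norm_abs_matrix mult_left_mono)
  finally show ?thesis .
qed

text \<open>Each exchange of a Frobenius norm for a spectral norm costs the square root of the
  number of columns. Exchanging one factor or both is the origin of the two powers
  \<open>n * sqrt n\<close> and \<open>n^2\<close> in the residual bound.\<close>

lemma norm_le_bound_product:
  assumes "norm D \<le> h * (norm (A :: real^'k^'m) * norm (B :: real^'n^'k))" "0 \<le> h"
  shows "norm D \<le> h * (sqrt CARD('k) * spectral_norm A * norm B)"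
    "norm D \<le> h * (sqrt CARD('k) * sqrt CARD('n) * (spectral_norm A * spectral_norm B))"
proof -
  have *: "norm A * norm B \<le> sqrt CARD('k) * spectral_norm A * norm B"
    by (intro mult_right_mono norm_le_sqrt_spectral_norm) auto
  then show "norm D \<le> h * (sqrt CARD('k) * spectral_norm A * norm B)"
    using assms by (meson mult_left_mono order_trans)
  have "sqrt CARD('k) * spectral_norm A * norm B
      \<le> sqrt CARD('k) * spectral_norm A * (sqrt CARD('n) * spectral_norm B)"
    by (intro mult_left_mono norm_le_sqrt_spectral_norm) (auto simp: spectral_norm_nonneg)
  with * have "norm A * norm B
      \<le> sqrt CARD('k) * sqrt CARD('n) * (spectral_norm A * spectral_norm B)"
    by (simp add: mult_ac)
  then show "norm D \<le> h * (sqrt CARD('k) * sqrt CARD('n) * (spectral_norm A * spectral_norm B))"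
    using assms by (meson mult_left_mono order_trans)
qed

lemma error_norm_le:
  fixes D A :: "real^'n^'m" and B :: "real^'n^'n" and u p q :: real
  defines "n \<equiv> real CARD('n)"
  assumes D: "norm D \<le> 51 / 50 * n * u * (norm A * norm B)" and u: "0 \<le> u"
    and A: "spectral_norm A \<le> p"
  shows "norm B \<le> q \<Longrightarrow> norm D \<le> 51 / 50 * (n * sqrt n * u) * (p * q)"
    and "spectral_norm B \<le> q \<Longrightarrow> norm D \<le> 51 / 50 * (n\<^sup>2 * u) * (p * q)"
proof -
  have cn: "0 \<le> 51 / 50 * n * u" using u by (simp add: n_def)
  have p: "0 \<le> p" using A spectral_norm_nonneg[of A] by linarith
  show "norm D \<le> 51 / 50 * (n * sqrt n * u) * (p * q)" if "norm B \<le> q"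
  proof -
    have "norm D \<le> 51 / 50 * n * u * (sqrt n * spectral_norm A * norm B)"
      using norm_le_bound_product(1)[OF D cn] by (simp add: n_def)
    also have "\<dots> = 51 / 50 * n * u * sqrt n * (spectral_norm A * norm B)" by simp
    also have "\<dots> \<le> 51 / 50 * n * u * sqrt n * (p * q)"
      using A that cn p by (intro mult_left_mono mult_mono) (auto simp: n_def)
    finally show ?thesis by (simp add: mult_ac)
  qed
  show "norm D \<le> 51 / 50 * (n\<^sup>2 * u) * (p * q)" if "spectral_norm B \<le> q"
  proof -
    have "norm D \<le> 51 / 50 * n * u * (n * (spectral_norm A * spectral_norm B))"
      using norm_le_bound_product(2)[OF D cn] by (simp add: n_def)
    also have "\<dots> = 51 / 50 * n * u * n * (spectral_norm A * spectral_norm B)" by simp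
    also have "\<dots> \<le> 51 / 50 * n * u * n * (p * q)"
      using A that cn p by (intro mult_left_mono mult_mono) (auto simp: n_def spectral_norm_nonneg)
    finally show ?thesis by (simp add: power2_eq_square mult_ac)
  qed
qed

text \<open>Perturbations of \<open>Y\<close> that change from row to row are in general not one
  perturbation of \<open>Y\<close>. Moved to the right-hand side, they become the rows of a single
  \<open>D\<close>.\<close>

lemma row_solve_backward_error:
  fixes W A :: "real^'n^'m" and Y :: "real^'n^'n"
  assumes "row_solve_computed u Y A W"
  obtains D where "W ** Y = A + D" "\<bar>D\<bar> \<le> gam u CARD('n) *\<^sub>R (\<bar>W\<bar> ** \<bar>Y\<bar>)"
proof -
  obtain E where E: "\<And>i. row i W v* (Y + E i) = row i A"
    and le: "\<And>i. \<bar>E i\<bar> \<le> gam u CARD('n) *\<^sub>R \<bar>Y\<bar>"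
    using assms unfolding row_solve_computed_def by metis
  define D where "D = (\<chi> i. - (row i W v* E i))"
  have "(W ** Y) $ i $ j = (A + D) $ i $ j" for i j
    using arg_cong[OF E[of i], of "\<lambda>x. x $ j"]
    by (simp add: D_def row_def vector_matrix_mult_def matrix_matrix_mult_def algebra_simps sum.distrib)
  moreover have "\<bar>D $ i $ j\<bar> \<le> gam u CARD('n) * (\<bar>W\<bar> ** \<bar>Y\<bar>) $ i $ j" for i j
  proof -
    have "\<bar>D $ i $ j\<bar> \<le> (\<Sum>k\<in>UNIV. \<bar>W $ i $ k\<bar> * \<bar>E i $ k $ j\<bar>)"
      unfolding D_def vector_matrix_mult_def row_def
      by (simp add: order_trans[OF sum_abs] abs_mult mult.commute)
    also have "\<dots> \<le> (\<Sum>k\<in>UNIV. \<bar>W $ i $ k\<bar> * (gam u CARD('n) * \<bar>Y $ k $ j\<bar>))"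
      using le[of i] by (intro sum_mono mult_left_mono) (auto simp: less_eq_vec_def abs_vec_def)
    also have "\<dots> = gam u CARD('n) * (\<bar>W\<bar> ** \<bar>Y\<bar>) $ i $ j"
      by (simp add: matrix_matrix_mult_def abs_vec_def sum_distrib_left mult_ac)
    finally show ?thesis .
  qed
  ultimately show ?thesis
    by (intro that[of D]) (auto simp: vec_eq_iff less_eq_vec_def abs_vec_def)
qed

section \<open>The smallest singular value\<close>

text \<open>Minimizing |A x| over the unit sphere of an invariant subspace produces an eigenvector
  of A^T A. On the whole space it gives the smallest singular value; on an orthogonal complement it
  drives the spectral theorem below.\<close>

lemma rayleigh_minimizer:
  fixes A :: "real^'n^'m" and V :: "(real^'n) set"
  assumes V: "subspace V" "V \<noteq> {0}"
    and inv: "\<And>v. v \<in> V \<Longrightarrow> (transpose A ** A) *v v \<in> V"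
  obtains x where "x \<in> V" "norm x = 1" "x \<in> sv_space A (norm (A *v x))"
    "\<And>y. y \<in> V \<Longrightarrow> norm (A *v x) * norm y \<le> norm (A *v y)"
proof -
  have ATA: "((transpose A ** A) *v x) \<bullet> y = (A *v x) \<bullet> (A *v y)" for x y
    by (metis dot_lmul_matrix matrix_vector_mul_assoc transpose_matrix_vector)
  let ?S = "sphere 0 1 \<inter> V"
  obtain w where w: "w \<in> V" "w \<noteq> 0"
    using V subspace_0 by blast
  then have "w /\<^sub>R norm w \<in> ?S"
    using V by (auto simp: subspace_scale)
  moreover have "compact ?S"
    using V by (intro compact_Int_closed compact_sphere closed_subspace)
  moreover have "continuous_on ?S (\<lambda>x. norm (A *v x))"
    by (rule continuous_on_norm, rule linear_continuous_on) simp
  ultimately obtain x where x: "x \<in> V" "norm x = 1"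
    and min: "\<And>y. y \<in> V \<Longrightarrow> norm y = 1 \<Longrightarrow> norm (A *v x) \<le> norm (A *v y)"
    using continuous_attains_inf[of ?S "\<lambda>x. norm (A *v x)"]
    by (metis (no_types, lifting) Int_iff empty_iff mem_sphere_0)
  have bound: "norm (A *v x) * norm y \<le> norm (A *v y)" if "y \<in> V" for y
  proof (cases "y = 0")
    case False
    have "norm (A *v x) \<le> norm (A *v (y /\<^sub>R norm y))"
      using that False V by (intro min) (auto simp: subspace_scale)
    also have "\<dots> = norm (A *v y) / norm y"
      by (simp add: matrix_vector_mult_scaleR divide_inverse_commute)
    finally show ?thesis using False by (simp add: field_simps)
  qed simp
  define \<mu> where "\<mu> = (norm (A *v x))\<^sup>2"
  \<comment> \<open>Half the gradient of |A y|^2 - \<mu> |y|^2 at the minimizer \<open>x\<close>.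
    Invariance keeps it in \<open>V\<close>, so \<open>x - s *\<^sub>R g\<close> is an admissible
    competitor.\<close>
  define g where "g = (transpose A ** A) *v x - \<mu> *\<^sub>R x"
  have gV: "g \<in> V"
    unfolding g_def using V inv x by (intro subspace_diff subspace_scale)
  have "2 * s * (g \<bullet> g) \<le> s\<^sup>2 * (norm (A *v g))\<^sup>2" if "s > 0" for s
  proof -
    have "\<mu> * (norm (x - s *\<^sub>R g))\<^sup>2 \<le> (norm (A *v (x - s *\<^sub>R g)))\<^sup>2"
      unfolding \<mu>_def power_mult_distrib[symmetric]
      using V x gV by (intro power_mono bound subspace_diff subspace_scale) auto
    moreover have "(norm (x - s *\<^sub>R g))\<^sup>2 = 1 - 2 * s * (x \<bullet> g) + s\<^sup>2 * (g \<bullet> g)"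
      using x unfolding power2_norm_eq_inner
      by (simp add: norm_eq_1 algebra_simps inner_commute power2_eq_square)
    moreover have "(norm (A *v (x - s *\<^sub>R g)))\<^sup>2
        = \<mu> - 2 * s * (((transpose A ** A) *v x) \<bullet> g) + s\<^sup>2 * (norm (A *v g))\<^sup>2"
      unfolding \<mu>_def ATA power2_norm_eq_inner
      by (simp add: matrix_vector_mult_diff_distrib matrix_vector_mult_scaleR algebra_simps inner_commute power2_eq_square)
    ultimately have "\<mu> * (1 - 2 * s * (x \<bullet> g) + s\<^sup>2 * (g \<bullet> g))
        \<le> \<mu> - 2 * s * (((transpose A ** A) *v x) \<bullet> g) + s\<^sup>2 * (norm (A *v g))\<^sup>2" by simp
    moreover have "((transpose A ** A) *v x) \<bullet> g = g \<bullet> g + \<mu> * (x \<bullet> g)"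
      unfolding g_def by (simp add: inner_diff_left inner_diff_right algebra_simps)
    moreover have "0 \<le> \<mu> * (s\<^sup>2 * (g \<bullet> g))" by (simp add: \<mu>_def)
    ultimately show ?thesis by (simp add: algebra_simps)
  qed
  then have le: "2 * (g \<bullet> g) \<le> s * (norm (A *v g))\<^sup>2" if "s > 0" for s
    using that by (simp add: power2_eq_square mult.assoc)
  \<comment> \<open>Letting \<open>s\<close> tend to 0 from above forces
    \<open>g \<bullet> g \<le> 0\<close>, which is the eigenvector equation.\<close>
  have "((\<lambda>s. s * (norm (A *v g))\<^sup>2) \<longlongrightarrow> 0 * (norm (A *v g))\<^sup>2) (at_right 0)"
    by (intro tendsto_intros)
  then have "2 * (g \<bullet> g) \<le> 0 * (norm (A *v g))\<^sup>2"
    by (rule tendsto_lowerbound) (auto intro: eventually_mono[OF eventually_at_right_less] le)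
  then have "\<not> 0 < g \<bullet> g" by linarith
  then have "g = 0" by simp
  then have "x \<in> sv_space A (norm (A *v x))"
    by (simp add: g_def \<mu>_def sv_space_def)
  with x bound that show ?thesis by blast
qed

section \<open>Eigenspaces of the Gram matrix\<close>

lemma norm_sv_space:
  fixes A :: "real^'n^'m"
  assumes "v \<in> sv_space A \<sigma>" "0 \<le> \<sigma>"
  shows "norm (A *v v) = \<sigma> * norm v"
proof -
  have "(norm (A *v v))\<^sup>2 = ((transpose A ** A) *v v) \<bullet> v"
    by (metis dot_lmul_matrix matrix_vector_mul_assoc transpose_matrix_vector power2_norm_eq_inner)
  also have "\<dots> = (\<sigma> * norm v)\<^sup>2"
    using assms by (simp add: sv_space_def power_mult_distrib power2_norm_eq_inner)
  finally show ?thesis using assms by simp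
qed

lemma sv_space_orthogonal:
  fixes A :: "real^'n^'m"
  assumes "v \<in> sv_space A \<sigma>" "w \<in> sv_space A \<tau>" "0 \<le> \<sigma>" "0 \<le> \<tau>" "\<sigma> \<noteq> \<tau>"
  shows "v \<bullet> w = 0"
proof -
  have "((transpose A ** A) *v v) \<bullet> w = v \<bullet> ((transpose A ** A) *v w)"
    by (metis dot_lmul_matrix matrix_transpose_mul transpose_matrix_vector transpose_transpose)
  then have "\<sigma>\<^sup>2 * (v \<bullet> w) = \<tau>\<^sup>2 * (v \<bullet> w)"
    using assms by (simp add: sv_space_def)
  moreover have "\<sigma>\<^sup>2 \<noteq> \<tau>\<^sup>2" using assms by simp
  ultimately show ?thesis by simp
qed

text \<open>\<open>sv_space\<close> depends only on the square of \<sigma>, so \<sigma> and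
  -\<sigma> share an eigenspace. Among non-negative values the eigenspaces are pairwise orthogonal
  and their dimensions add.\<close>

lemma dim_UN_sv_space:
  fixes A :: "real^'n^'m"
  assumes "finite F" "F \<subseteq> {0..}"
  shows "dim (\<Union>\<sigma>\<in>F. sv_space A \<sigma>) = (\<Sum>\<sigma>\<in>F. dim (sv_space A \<sigma>))"
  using assms
proof (induction F)
  case (insert \<tau> F)
  have "dim (sv_space A \<tau> \<union> (\<Union>\<sigma>\<in>F. sv_space A \<sigma>)) = dim (sv_space A \<tau>) + dim (\<Union>\<sigma>\<in>F. sv_space A \<sigma>)"
    using insert by (intro dim_orthogonal_sum) (auto intro!: sv_space_orthogonal)
  with insert show ?case by simp
qed simp

lemma singular_values_nonneg: "singular_values A \<subseteq> {0..}"
  by (auto simp: singular_values_def)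

lemma dim_sv_space_pos:
  fixes A :: "real^'n^'m"
  assumes "\<sigma> \<in> singular_values A"
  shows "1 \<le> dim (sv_space A \<sigma>)"
proof -
  have "\<not> sv_space A \<sigma> \<subseteq> {0}" using assms by (auto simp: singular_values_def)
  then show ?thesis using dim_eq_0[of "sv_space A \<sigma>"] by linarith
qed

text \<open>Pairwise orthogonal eigenspaces of dimension at least 1: at most n of them fit.\<close>

lemma finite_singular_values:
  fixes A :: "real^'n^'m"
  shows "finite (singular_values A)"
proof (rule conjunct1[OF finite_if_finite_subsets_card_bdd[where C="CARD('n)"]])
  fix F assume F: "F \<subseteq> singular_values A" "finite F"
  have "card F \<le> (\<Sum>\<sigma>\<in>F. dim (sv_space A \<sigma>))"
    using F dim_sv_space_pos sum_mono[of F "\<lambda>_. 1" "\<lambda>\<sigma>. dim (sv_space A \<sigma>)"] by auto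
  also have "\<dots> \<le> CARD('n)"
    using F dim_UN_sv_space[of F A] singular_values_nonneg[of A]
      dim_subset_UNIV_cart[of "\<Union>\<sigma>\<in>F. sv_space A \<sigma>"] by simp
  finally show "card F \<le> CARD('n)" .
qed

text \<open>The spectral theorem for A^T A. By symmetry the orthogonal complement of all eigenspaces
  is invariant; were it nonzero, \<open>rayleigh_minimizer\<close> would find in it an eigenvector
  orthogonal to itself.\<close>

lemma span_sv_spaces:
  fixes A :: "real^'n^'m"
  shows "span (\<Union>\<sigma>\<in>singular_values A. sv_space A \<sigma>) = UNIV"
proof (rule ccontr)
  let ?U = "\<Union>\<sigma>\<in>singular_values A. sv_space A \<sigma>"
  define V where "V = {x. \<forall>y\<in>?U. x \<bullet> y = 0}"
  assume "span ?U \<noteq> UNIV"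
  then have "dim ?U < DIM(real^'n)"
    using dim_eq_full[of ?U] dim_subset_UNIV[of ?U] by linarith
  then obtain z where "z \<noteq> 0" "\<And>y. y \<in> span ?U \<Longrightarrow> orthogonal z y"
    using orthogonal_to_subspace_exists by blast
  then have "V \<noteq> {0}"
    by (force simp: V_def orthogonal_def intro: span_base)
  moreover have "subspace V"
    by (auto simp: V_def subspace_def inner_add_left)
  moreover have "(transpose A ** A) *v v \<in> V" if "v \<in> V" for v
  proof -
    have "((transpose A ** A) *v v) \<bullet> y = v \<bullet> ((transpose A ** A) *v y)" for y
      by (metis dot_lmul_matrix matrix_transpose_mul transpose_matrix_vector transpose_transpose)
    with that show ?thesis
      by (fastforce simp: V_def sv_space_def)
  qed
  ultimately obtain x where x: "x \<in> V" "norm x = 1" "x \<in> sv_space A (norm (A *v x))"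
    by (metis rayleigh_minimizer)
  then have "x \<in> ?U" by (auto simp: singular_values_def intro!: exI[of _ "norm (A *v x)"] bexI[of _ x])
  with x have "x \<bullet> x = 0" unfolding V_def by blast
  with x show False by (simp add: norm_eq_1)
qed

text \<open>Links the counting definition, at index n, with the minimum of |A v| over unit vectors.
  All later lower bounds start from here.\<close>

lemma singular_value_CARD_bound:
  fixes A :: "real^'n^'m"
  shows "0 \<le> singular_value CARD('n) A"
    and "singular_value CARD('n) A * norm v \<le> norm (A *v v)"
proof -
  let ?S = "singular_values A" and ?d = "\<lambda>\<sigma>. dim (sv_space A \<sigma>)"
  have "(UNIV :: (real^'n) set) \<noteq> {0}"
    by (metis UNIV_I singletonD norm_axis_1 norm_zero zero_neq_one)
  then obtain x :: "real^'n" where x: "norm x = 1" "x \<in> sv_space A (norm (A *v x))"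
    and min: "\<And>y. norm (A *v x) * norm y \<le> norm (A *v y)"
    using rayleigh_minimizer[of UNIV A] by (metis UNIV_I subspace_UNIV)
  define \<sigma> where "\<sigma> = norm (A *v x)"
  have S: "\<sigma> \<in> ?S" using x by (auto simp: singular_values_def \<sigma>_def intro!: bexI[of _ x])
  have le: "\<sigma> \<le> \<tau>" if \<tau>: "\<tau> \<in> ?S" for \<tau>
  proof -
    obtain y where y: "y \<in> sv_space A \<tau>" "y \<noteq> 0" "0 \<le> \<tau>"
      using \<tau> by (auto simp: singular_values_def)
    with min[of y] norm_sv_space[OF y(1,3)] show ?thesis by (simp add: \<sigma>_def)
  qed
  have "dim (\<Union>\<sigma>\<in>?S. sv_space A \<sigma>) = CARD('n)"
    by (metis dim_span span_sv_spaces vec_dim_card dim_UNIV DIM_cart DIM_real mult.right_neutral)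
  then have total: "(\<Sum>\<tau>\<in>?S. ?d \<tau>) = CARD('n)"
    using dim_UN_sv_space[OF finite_singular_values, of A A] singular_values_nonneg[of A] by simp
  \<comment> \<open>The dimensions of all eigenspaces sum to n. A singular value above \<sigma>
    misses the eigenspace of \<sigma>, of dimension at least 1, so its count stays below n and
    \<open>Max\<close> is taken over a singleton.\<close>
  have "{\<tau> \<in> ?S. CARD('n) \<le> (\<Sum>\<tau>' | \<tau>' \<in> ?S \<and> \<tau> \<le> \<tau>'. ?d \<tau>')} = {\<sigma>}" (is "?M = _")
  proof (intro equalityI subsetI)
    fix \<tau> assume \<tau>: "\<tau> \<in> ?M"
    show "\<tau> \<in> {\<sigma>}"
    proof (rule ccontr)
      assume "\<tau> \<notin> {\<sigma>}"
      with le[of \<tau>] \<tau> have "\<sigma> < \<tau>" by auto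
      then have "(\<Sum>\<tau>' | \<tau>' \<in> ?S \<and> \<tau> \<le> \<tau>'. ?d \<tau>') \<le> (\<Sum>\<tau>'\<in>?S - {\<sigma>}. ?d \<tau>')"
        by (intro sum_mono2) (auto simp: finite_singular_values)
      moreover have "CARD('n) = ?d \<sigma> + (\<Sum>\<tau>'\<in>?S - {\<sigma>}. ?d \<tau>')"
        using sum.remove[OF finite_singular_values S, of ?d] total by simp
      ultimately show False using \<tau> dim_sv_space_pos[OF S] by simp
    qed
  next
    fix \<tau> assume "\<tau> \<in> {\<sigma>}"
    moreover have "{\<tau>' \<in> ?S. \<sigma> \<le> \<tau>'} = ?S" using le by auto
    ultimately show "\<tau> \<in> ?M" using S total by simp
  qed
  then have "singular_value CARD('n) A = \<sigma>" by (simp add: singular_value_def)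
  then show "0 \<le> singular_value CARD('n) A" "singular_value CARD('n) A * norm v \<le> norm (A *v v)"
    using min by (auto simp: \<sigma>_def)
qed

section \<open>One Cholesky QR step\<close>

text \<open>The lower bound makes a square matrix injective, hence invertible; read at
  \<open>B *v w\<close>, the same bound limits the norm of the inverse.\<close>

lemma injective_matrix_inverse:
  fixes Y :: "real^'n^'n"
  assumes lower: "\<And>v. l * norm v \<le> norm (Y *v v)" and "0 < l"
  obtains B where "Y ** B = mat 1" "spectral_norm B \<le> 1 / l"
proof -
  have "v = 0" if "Y *v v = 0" for v
    using lower[of v] that \<open>0 < l\<close> by (simp add: mult_le_0_iff)
  then obtain B where "B ** Y = mat 1"
    using matrix_left_invertible_ker by blast
  then have B: "Y ** B = mat 1" by (simp add: matrix_left_right_inverse)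
  have "norm (B *v w) \<le> 1 / l * norm w" for w
    using lower[of "B *v w"] \<open>0 < l\<close> B by (simp add: matrix_vector_mul_assoc field_simps)
  then show ?thesis using B that spectral_norm_leI by blast
qed

text \<open>The squared lengths are the quadratic forms of the Gram matrices, so they differ by v .
  F v. The row counts of \<open>Y\<close> and \<open>W\<close> may differ, so this serves for
  Cholesky factors as well as for the nearly orthonormal \<open>H\<close>.\<close>

lemma gram_perturbation:
  fixes Y :: "real^'n^'k" and W :: "real^'n^'m"
  assumes "transpose Y ** Y = transpose W ** W + F"
  shows "\<bar>(norm (Y *v v))\<^sup>2 - (norm (W *v v))\<^sup>2\<bar> \<le> norm F * (norm v)\<^sup>2"
proof -
  have gram: "(norm (A *v v))\<^sup>2 = v \<bullet> ((transpose A ** A) *v v)" for A :: "real^'n^'a"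
    by (simp add: matrix_vector_mul_assoc[symmetric] dot_lmul_matrix[symmetric] power2_norm_eq_inner inner_commute)
  have "\<bar>(norm (Y *v v))\<^sup>2 - (norm (W *v v))\<^sup>2\<bar> = \<bar>v \<bullet> (F *v v)\<bar>"
    unfolding gram assms by (simp add: matrix_vector_mult_add_rdistrib inner_add_right)
  also have "\<dots> \<le> norm v * (norm F * norm v)"
    by (meson Cauchy_Schwarz_ineq2 mult_left_mono norm_ge_zero norm_mult_vec_le order_trans)
  finally show ?thesis by (simp add: power2_eq_square mult_ac)
qed

lemma transpose_add: "transpose (A + B) = transpose A + transpose (B :: real^'n^'m)"
  by (simp add: transpose_def vec_eq_iff)

lemma abs_transpose: "\<bar>transpose A\<bar> = transpose \<bar>A :: real^'n^'m\<bar>"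
  by (simp add: transpose_def abs_vec_def vec_eq_iff)

text \<open>\<open>h / l\<close> stands in for the condition number of \<open>W\<close>. The Gram
  error is small against l^2, so \<open>Y\<close> nearly reproduces the lengths |W v| and V = (W +
  D) Y^-1 is nearly an isometry. The bounds 0.979 and 1.021 involve neither \<open>h\<close> nor
  \<open>l\<close>, so the lemma can be applied again to \<open>V\<close>.\<close>

lemma cholesky_qr_step:
  fixes W V :: "real^'n::{finite,linorder}^'m" and G Y :: "real^'n::{finite,linorder}^'n::{finite,linorder}" and u :: real
  defines "m \<equiv> real CARD('m)" and "n \<equiv> real CARD('n)"
  defines "\<delta> \<equiv> m * n * u + n * (n + 1) * u"
  assumes gram: "product_computed u (transpose W) W G"
    and chol: "cholesky_computed u G Y"
    and solve: "row_solve_computed u Y W V"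
    and u: "0 \<le> u" "gam u m \<le> 51 / 50 * m * u" "gam u n \<le> 51 / 50 * n * u"
      "gam u (n + 1) \<le> 51 / 50 * (n + 1) * u"
    and upper: "spectral_norm W \<le> h" and lower: "\<And>v. l * norm v \<le> norm (W *v v)" and l: "0 < l"
    and small: "\<delta> * (h / l)\<^sup>2 \<le> 1 / 80"
  obtains D where "V ** Y = W + D" "norm D \<le> 51 / 50 * n * u * (norm V * norm Y)"
    "spectral_norm Y \<le> 1013 / 1000 * h" "spectral_norm V \<le> (1021 / 1000)"
    "\<And>w. (979 / 1000) * norm w \<le> norm (V *v w)"
    "norm (transpose V ** V - mat 1) \<le> 33 / 10 * \<delta> * (h / l)\<^sup>2"
proof -
  define p where "p = m * n * u"
  define r where "r = n * (n + 1) * u"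
  have mn: "m \<ge> 0" "n \<ge> 1" by (simp_all add: m_def n_def Suc_le_eq)
  have pr: "0 \<le> p" "0 \<le> r" "\<delta> = p + r" using mn u by (simp_all add: p_def r_def \<delta>_def)
  have lh: "l \<le> h"
    using lower[of "axis undefined 1"] norm_mult_vec_le_onorm[of W "axis undefined 1"] upper by simp
  then have h: "0 < h" using l by simp
  have hl: "1 \<le> h / l" using lh l by simp
  \<comment> \<open>As \<open>h / l\<close> is at least 1, \<open>small\<close> also bounds \<delta>
    (h / l) and \<delta> by 1/80. The numerical constants below rest on these three bounds.\<close>
  have "h / l \<le> (h / l)\<^sup>2" using self_le_power[of "h / l" 2] hl by simp
  then have "\<delta> * (h / l) \<le> 1 / 80"
    using small pr by (meson add_nonneg_nonneg mult_left_mono order_trans)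
  then have \<delta>h: "\<delta> * h \<le> l / 80" using l by (simp add: field_simps)
  have \<delta>hh: "\<delta> * h\<^sup>2 \<le> l\<^sup>2 / 80" using small l by (simp add: field_simps)
  have "\<delta> * 1 \<le> \<delta> * (h / l)" using hl pr by (intro mult_left_mono) auto
  with \<open>\<delta> * (h / l) \<le> 1 / 80\<close> have \<delta>1: "\<delta> \<le> 1 / 80" by linarith

  define y where "y = spectral_norm Y"
  define x where "x = spectral_norm V"
  have xy: "0 \<le> x" "0 \<le> y" by (simp_all add: x_def y_def spectral_norm_nonneg)
  obtain D1 where D1: "G = transpose W ** W + D1" "\<bar>D1\<bar> \<le> gam u m *\<^sub>R (\<bar>transpose W\<bar> ** \<bar>W\<bar>)"
    using gram by (auto simp: product_computed_def m_def)
  obtain D2 where D2: "transpose Y ** Y = G + D2" "\<bar>D2\<bar> \<le> gam u (n + 1) *\<^sub>R (\<bar>transpose Y\<bar> ** \<bar>Y\<bar>)"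
    using chol by (auto simp: cholesky_computed_def n_def abs_transpose)
  define F where "F = D1 + D2"
  have YW: "transpose Y ** Y = transpose W ** W + F"
    using D1 D2 by (simp add: F_def)
  have "norm W \<le> sqrt n * spectral_norm W"
    unfolding n_def by (rule norm_le_sqrt_spectral_norm)
  also have "\<dots> \<le> sqrt n * h"
    using upper mn by (intro mult_left_mono) auto
  finally have "norm W \<le> sqrt n * h" .
  then have "norm W * norm W \<le> (sqrt n * h) * (sqrt n * h)"
    by (intro mult_mono) (use h mn in auto)
  then have WW: "norm W * norm W \<le> n * h\<^sup>2"
    using mn by (simp add: power2_eq_square mult_ac)
  have "norm D1 \<le> 51 / 50 * m * u * (norm (transpose W) * norm W)"
    by (rule norm_abs_le_product[OF D1(2)]) (use u mn in auto)
  also have "\<dots> \<le> 51 / 50 * m * u * (n * h\<^sup>2)"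
    using WW u mn by (intro mult_left_mono) (auto simp: norm_transpose)
  finally have nD1: "norm D1 \<le> 51 / 50 * (p * h\<^sup>2)" by (simp add: p_def mult_ac)
  have "norm Y * norm Y \<le> (sqrt n * y) * (sqrt n * y)"
    unfolding y_def n_def by (intro mult_mono norm_le_sqrt_spectral_norm) (auto simp: spectral_norm_nonneg)
  then have YY: "norm Y * norm Y \<le> n * y\<^sup>2"
    using mn by (simp add: power2_eq_square mult_ac)
  have "norm D2 \<le> 51 / 50 * (n + 1) * u * (norm (transpose Y) * norm Y)"
    by (rule norm_abs_le_product[OF D2(2)]) (use u mn in auto)
  also have "\<dots> \<le> 51 / 50 * (n + 1) * u * (n * y\<^sup>2)"
    using YY u mn by (intro mult_left_mono) (auto simp: norm_transpose)
  finally have nD2: "norm D2 \<le> 51 / 50 * (r * y\<^sup>2)" by (simp add: r_def algebra_simps)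
  have f1: "norm F \<le> 51 / 50 * (p * h\<^sup>2) + (51 / 50) * (r * y\<^sup>2)"
    using nD1 nD2 norm_triangle_ineq[of D1 D2] by (simp add: F_def)
  have WF: "\<bar>(norm (Y *v v))\<^sup>2 - (norm (W *v v))\<^sup>2\<bar> \<le> norm F * (norm v)\<^sup>2" for v
    by (rule gram_perturbation[OF YW])
  have Wh: "norm (W *v v) \<le> h * norm v" for v
    using norm_mult_vec_le_onorm[of W v] upper by (meson mult_right_mono norm_ge_zero order_trans)
  have "norm (Y *v v) \<le> sqrt (h\<^sup>2 + norm F) * norm v" for v
  proof -
    have "(norm (W *v v))\<^sup>2 \<le> (h * norm v)\<^sup>2"
      using Wh by (intro power_mono) auto
    then have "(norm (Y *v v))\<^sup>2 \<le> (sqrt (h\<^sup>2 + norm F) * norm v)\<^sup>2"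
      using WF[of v] by (simp add: power_mult_distrib algebra_simps abs_le_iff)
    then show ?thesis by (rule power2_le_imp_le) simp
  qed
  \<comment> \<open>The bound on \<open>F\<close> involves \<open>y\<close> itself. Because r <=
    1/80 the term in y^2 can be absorbed: (1 + 1.02/80) / (1 - 1.02/80) < 1.026, and 1.026 <
    1.013^2.\<close>
  then have "y \<le> sqrt (h\<^sup>2 + norm F)" unfolding y_def by (rule spectral_norm_leI)
  then have "y\<^sup>2 \<le> h\<^sup>2 + norm F" using xy by (simp add: real_le_rsqrt sqrt_ge_absD)
  moreover have "p * h\<^sup>2 + r * h\<^sup>2 \<le> h\<^sup>2 / 80"
    using mult_right_mono[OF \<delta>1, of "h\<^sup>2"] pr by (simp add: algebra_simps)
  moreover have "r * y\<^sup>2 \<le> y\<^sup>2 / 80"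
    using mult_right_mono[of r "1/80" "y\<^sup>2"] pr \<delta>1 by simp
  moreover have "0 \<le> p * h\<^sup>2" "0 \<le> r * h\<^sup>2" using pr by simp_all
  ultimately have y2: "y\<^sup>2 \<le> 513 / 500 * h\<^sup>2" using f1 zero_le_power2[of h] by linarith
  also have "\<dots> \<le> ((1013 / 1000) * h)\<^sup>2" by (simp add: power_mult_distrib power2_eq_square)
  finally have y: "y \<le> 1013 / 1000 * h" by (rule power2_le_imp_le) (use h in simp)
  have "r * y\<^sup>2 \<le> r * ((513 / 500) * h\<^sup>2)" using y2 pr by (intro mult_left_mono)
  then have f2: "norm F \<le> 1047 / 1000 * (\<delta> * h\<^sup>2)"
    using f1 \<open>0 \<le> p * h\<^sup>2\<close> \<open>0 \<le> r * h\<^sup>2\<close> pr(3) by (simp add: algebra_simps)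
  \<comment> \<open>Here 1.047/80 < 0.0131. Since l |v| <= |W v|, the absolute Gram error becomes a
    relative error of |W v|^2 at every \<open>v\<close>.\<close>
  then have f3: "norm F \<le> 131 / 10000 * l\<^sup>2" using \<delta>hh zero_le_power2[of l] by linarith
  have WF': "\<bar>(norm (Y *v v))\<^sup>2 - (norm (W *v v))\<^sup>2\<bar> \<le> 131 / 10000 * (norm (W *v v))\<^sup>2" for v
  proof -
    have "norm F * (norm v)\<^sup>2 \<le> 131 / 10000 * l\<^sup>2 * (norm v)\<^sup>2"
      using f3 by (intro mult_right_mono) auto
    also have "\<dots> = 131 / 10000 * (l * norm v)\<^sup>2" by (simp add: power_mult_distrib)
    also have "\<dots> \<le> 131 / 10000 * (norm (W *v v))\<^sup>2"
      using lower l by (intro mult_left_mono power_mono) auto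
    finally show ?thesis using WF[of v] by simp
  qed
  \<comment> \<open>1.0067 exceeds 1 / sqrt (1 - 0.0131); the factor 1.00655 of \<open>YW'\<close>
    exceeds sqrt 1.0131.\<close>
  have WY: "norm (W *v v) \<le> 10067 / 10000 * norm (Y *v v)" for v
  proof (rule power2_le_imp_le)
    show "(norm (W *v v))\<^sup>2 \<le> ((10067 / 10000) * norm (Y *v v))\<^sup>2"
      using WF'[of v, unfolded abs_le_iff] zero_le_power2[of "norm (Y *v v)"]
      unfolding power_mult_distrib by (simp add: power2_eq_square[of "_ / _"])
  qed simp
  have YW': "norm (Y *v v) \<le> 20131 / 20000 * norm (W *v v)" for v
  proof (rule power2_le_imp_le)
    show "(norm (Y *v v))\<^sup>2 \<le> ((20131 / 20000) * norm (W *v v))\<^sup>2"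
      using WF'[of v, unfolded abs_le_iff] zero_le_power2[of "norm (W *v v)"]
      unfolding power_mult_distrib by (simp add: power2_eq_square[of "_ / _"])
  qed simp
  have Ylow: "993 / 1000 * l * norm v \<le> norm (Y *v v)" for v
    using WY[of v] lower[of v] norm_ge_zero[of "Y *v v"] by linarith
  obtain B where B: "Y ** B = mat 1" "spectral_norm B \<le> 1 / ((993 / 1000) * l)"
    using injective_matrix_inverse[OF Ylow] l by auto

  obtain D where D: "V ** Y = W + D" "\<bar>D\<bar> \<le> gam u n *\<^sub>R (\<bar>V\<bar> ** \<bar>Y\<bar>)"
    using row_solve_backward_error[OF solve] n_def by metis
  have nD: "norm D \<le> 51 / 50 * n * u * (norm V * norm Y)"
    by (rule norm_abs_le_product[OF D(2)]) (use u mn in auto)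
  have "norm D \<le> 51 / 50 * n * u * (n * (x * y))"
    using norm_le_bound_product(2)[OF nD] u mn unfolding x_def y_def by (simp add: n_def)
  also have "\<dots> = 51 / 50 * (n * n * u * (x * y))" by simp
  also have "\<dots> \<le> 51 / 50 * (r * (x * y))"
    unfolding r_def using u mn xy by (intro mult_left_mono mult_right_mono) auto
  also have "\<dots> \<le> 51 / 50 * (r * (x * ((1013 / 1000) * h)))"
    using y pr xy by (intro mult_left_mono) auto
  finally have d1: "norm D \<le> 51663 / 50000 * (r * h) * x" by (simp add: mult_ac)
  have rh: "r * h \<le> \<delta> * h" using pr h by (intro mult_right_mono) auto
  note d1
  also have "51663 / 50000 * (r * h) * x \<le> 51663 / 50000 * (l / 80) * x"
    using order_trans[OF rh \<delta>h] xy by (intro mult_right_mono mult_left_mono) auto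
  also have "\<dots> = (51663 / 50000) / 80 * (x * l)" by simp
  also have "\<dots> \<le> 323 / 25000 * (x * l)"
    using xy l by (intro mult_right_mono) auto
  finally have d2: "norm D \<le> 323 / 25000 * x * l" by simp
  have Dv: "norm (D *v v) \<le> 323 / 25000 * x * norm (W *v v)" for v
  proof -
    have "norm (D *v v) \<le> norm D * norm v" by (rule norm_mult_vec_le)
    also have "\<dots> \<le> 323 / 25000 * x * l * norm v" using d2 by (intro mult_right_mono) auto
    also have "\<dots> = 323 / 25000 * x * (l * norm v)" by simp
    also have "\<dots> \<le> 323 / 25000 * x * norm (W *v v)" using lower xy by (intro mult_left_mono) auto
    finally show ?thesis .
  qed
  have Vw: "V *v w = W *v (B *v w) + D *v (B *v w)" "Y *v (B *v w) = w" for w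
  proof -
    have "V *v w = (V ** Y) *v (B *v w)"
      by (metis B(1) matrix_vector_mul_assoc matrix_vector_mul_lid)
    then show "V *v w = W *v (B *v w) + D *v (B *v w)"
      by (simp add: D(1) matrix_vector_mult_add_rdistrib)
    show "Y *v (B *v w) = w" by (simp add: matrix_vector_mul_assoc B(1))
  qed
  have "norm (V *v w) \<le> (1 + (323 / 25000) * x) * (10067 / 10000) * norm w" for w
  proof -
    have "norm (V *v w) \<le> (1 + (323 / 25000) * x) * norm (W *v (B *v w))"
      using norm_triangle_ineq[of "W *v (B *v w)" "D *v (B *v w)"] Dv[of "B *v w"]
      by (simp add: Vw(1) algebra_simps)
    also have "\<dots> \<le> (1 + (323 / 25000) * x) * ((10067 / 10000) * norm w)"
      using WY[of "B *v w"] xy by (intro mult_left_mono) (auto simp: Vw(2))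
    finally show ?thesis by (simp only: mult.assoc)
  qed
  \<comment> \<open>Again implicit, since the solve error is a multiple of \<open>x\<close>. The
    coefficient 0.01292 * 1.0067 is far below 1, and solving for \<open>x\<close> gives less than
    1.021.\<close>
  then have "x \<le> (1 + (323 / 25000) * x) * (10067 / 10000)" unfolding x_def by (rule spectral_norm_leI)
  then have x: "x \<le> (1021 / 1000)" by simp
  have Vlow: "979 / 1000 * norm w \<le> norm (V *v w)" for w
  proof -
    let ?a = "norm (W *v (B *v w))"
    have "norm (D *v (B *v w)) \<le> 323 / 25000 * (1021 / 1000) * ?a"
      using Dv[of "B *v w"] x mult_right_mono[OF x, of ?a] by simp
    moreover have "?a \<le> norm (V *v w) + norm (D *v (B *v w))"
      using norm_triangle_ineq4[of "V *v w" "D *v (B *v w)"] by (simp add: Vw(1))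
    moreover have "norm w \<le> 20131 / 20000 * ?a" using YW'[of "B *v w"] by (simp add: Vw(2))
    moreover have "0 \<le> ?a" by simp
    ultimately show ?thesis by linarith
  qed

  \<comment> \<open>As V = (W + D) B with Y B = I, the departure from orthogonality is B^T M B: two
    first-order cross terms, one quadratic term, and the Gram and Cholesky errors
    \<open>F\<close>.\<close>
  define M where "M = transpose W ** D + transpose D ** W + transpose D ** D - F"
  have "transpose (V ** Y) ** (V ** Y) - transpose Y ** Y = M"
    unfolding D(1) YW M_def transpose_add by (simp add: matrix_add_ldistrib matrix_add_rdistrib)
  then have "transpose B ** (transpose (V ** Y) ** (V ** Y)) ** B - transpose B ** (transpose Y ** Y) ** B
      = transpose B ** M ** B"
    by (metis matrix_diff_ldistrib matrix_diff_rdistrib)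
  moreover have "transpose B ** (transpose (V ** Y) ** (V ** Y)) ** B
      = transpose (V ** (Y ** B)) ** (V ** (Y ** B))"
    by (simp add: matrix_transpose_mul matrix_mul_assoc)
  moreover have "transpose B ** (transpose Y ** Y) ** B = transpose (Y ** B) ** (Y ** B)"
    by (simp add: matrix_transpose_mul matrix_mul_assoc)
  ultimately have "transpose V ** V - mat 1 = transpose B ** M ** B"
    by (simp add: B(1))
  then have "norm (transpose V ** V - mat 1) \<le> norm (transpose B ** M) * spectral_norm B"
    by (simp add: norm_matrix_mult_le_right)
  also have "\<dots> \<le> (spectral_norm B * norm M) * spectral_norm B"
    using norm_matrix_mult_le_left[of "transpose B" M]
    by (intro mult_right_mono) (auto simp: spectral_norm_transpose spectral_norm_nonneg)
  also have "\<dots> \<le> (1 / ((993 / 1000) * l) * norm M) * (1 / ((993 / 1000) * l))"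
    using B(2) l by (intro mult_mono) (auto simp: spectral_norm_nonneg)
  also have "\<dots> = norm M / ((993 / 1000) * l)\<^sup>2" by (simp add: power2_eq_square)
  finally have VV: "norm (transpose V ** V - mat 1) \<le> norm M / ((993 / 1000) * l)\<^sup>2" .
  have "norm D \<le> 51663 / 50000 * (r * h) * (1021 / 1000)"
    using order_trans[OF d1 mult_left_mono[OF x]] pr h by simp
  then have d3: "norm D \<le> 211 / 200 * (\<delta> * h)"
    using rh mult_nonneg_nonneg[OF pr(2), of h] h by linarith
  have "norm (transpose W ** D) \<le> h * norm D"
    using norm_matrix_mult_le_left[of "transpose W" D] upper
    by (simp add: spectral_norm_transpose) (meson mult_right_mono norm_ge_zero order_trans)
  moreover have "norm (transpose D ** W) = norm (transpose W ** D)"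
    by (metis norm_transpose matrix_transpose_mul transpose_transpose)
  moreover have "norm (transpose D ** D) \<le> norm D * norm D"
    using norm_matrix_mult_le[of "transpose D" D] by (simp add: norm_transpose)
  moreover have "norm M \<le> norm (transpose W ** D) + norm (transpose D ** W) + norm (transpose D ** D) + norm F"
    unfolding M_def by (smt (verit) norm_triangle_ineq norm_triangle_ineq4)
  moreover have hd: "h * norm D \<le> 211 / 200 * (\<delta> * h\<^sup>2)"
    using mult_left_mono[OF d3, of h] h by (simp add: power2_eq_square mult_ac)
  moreover have "norm D * norm D \<le> 7 / 500 * (\<delta> * h\<^sup>2)"
  proof -
    have "norm D \<le> 33 / 2500 * h" using d3 \<delta>h lh h by linarith
    then have "norm D * norm D \<le> 33 / 2500 * h * norm D" by (intro mult_right_mono) auto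
    moreover have "0 \<le> \<delta> * h\<^sup>2" using pr by simp
    ultimately show ?thesis using hd by linarith
  qed
  \<comment> \<open>3.171 = 2 * 1.055 + 0.014 + 1.047, and 3.171 / 0.993^2 stays below 3.3.\<close>
  ultimately have "norm M \<le> 3171 / 1000 * (\<delta> * h\<^sup>2)" using f2 by linarith
  then have "norm M / ((993 / 1000) * l)\<^sup>2 \<le> 3171 / 1000 * (\<delta> * h\<^sup>2) / ((993 / 1000) * l)\<^sup>2"
    by (intro divide_right_mono) auto
  also have "\<dots> = (3171 / 1000) / (993 / 1000)\<^sup>2 * (\<delta> * (h / l)\<^sup>2)"
    by (simp add: power_mult_distrib power_divide)
  also have "\<dots> \<le> 33 / 10 * (\<delta> * (h / l)\<^sup>2)"
    using pr by (intro mult_right_mono) (auto simp: power2_eq_square)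
  finally have "norm (transpose V ** V - mat 1) \<le> 33 / 10 * (\<delta> * (h / l)\<^sup>2)"
    using VV by (rule order_trans[rotated])
  then have "norm (transpose V ** V - mat 1) \<le> 33 / 10 * \<delta> * (h / l)\<^sup>2"
    by (simp only: mult.assoc)
  with D(1) nD y x Vlow show ?thesis
    unfolding x_def y_def by (intro that) auto
qed

section \<open>The preconditioned matrix\<close>

text \<open>\<open>gram_perturbation\<close> against the identity; the constants exceed 1 / sqrt
  0.99 and sqrt 1.01.\<close>

lemma near_isometry_bounds:
  fixes H :: "real^'n^'s"
  assumes "norm (transpose H ** H - mat 1) \<le> 1 / 100"
  shows "norm w \<le> 100505 / 100000 * norm (H *v w)" "norm (H *v w) \<le> 1005 / 1000 * norm w"
proof -
  have "\<bar>(norm (H *v w))\<^sup>2 - (norm (mat 1 *v w :: real^'n))\<^sup>2\<bar>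
      \<le> norm (transpose H ** H - mat 1) * (norm w)\<^sup>2"
    by (rule gram_perturbation) simp
  also have "\<dots> \<le> 1 / 100 * (norm w)\<^sup>2" using assms by (intro mult_right_mono) auto
  finally have *: "\<bar>(norm (H *v w))\<^sup>2 - (norm w)\<^sup>2\<bar> \<le> 1 / 100 * (norm w)\<^sup>2" by simp
  show "norm w \<le> 100505 / 100000 * norm (H *v w)"
  proof (rule power2_le_imp_le)
    show "(norm w)\<^sup>2 \<le> ((100505 / 100000) * norm (H *v w))\<^sup>2"
      using *[unfolded abs_le_iff] zero_le_power2[of "norm w"]
      unfolding power_mult_distrib by (simp add: power2_eq_square[of "_ / _"])
  qed simp
  show "norm (H *v w) \<le> 1005 / 1000 * norm w"
  proof (rule power2_le_imp_le)
    show "(norm (H *v w))\<^sup>2 \<le> ((1005 / 1000) * norm w)\<^sup>2"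
      using *[unfolded abs_le_iff] zero_le_power2[of "norm w"]
      unfolding power_mult_distrib by (simp add: power2_eq_square[of "_ / _"])
  qed simp
qed

text \<open>Here H Y0 = Om L + D + E. Since 25.5 = 1.02 / 0.04, the conditioning restriction makes
  both errors together at most 4 percent of a l, hence of a |L v|. Removing the near-isometry
  \<open>H\<close> turns 0.96 and 1.04 into 0.9552 and 1.0453.\<close>

lemma sketched_qr_bounds:
  fixes Om :: "real^'m^'s" and L :: "real^'n::{finite,linorder}^'m"
    and Ls H :: "real^'n::{finite,linorder}^'s" and Y0 :: "real^'n::{finite,linorder}^'n::{finite,linorder}"
    and a b c l u :: real
  defines "m \<equiv> real CARD('m)" and "n \<equiv> real CARD('n)" and "s \<equiv> real CARD('s)"
  defines "t \<equiv> (51 / 50) * m * u * sqrt n * norm Om"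
  assumes embed: "\<And>v. a * norm (L *v v) \<le> norm (Om *v (L *v v))"
      "\<And>v. norm (Om *v (L *v v)) \<le> b * norm (L *v v)"
    and ab: "0 < a" "a \<le> b"
    and Ls: "product_computed u Om L Ls"
    and qr: "householder_qr_computed u c Ls H Y0"
    and u: "0 \<le> u" "0 \<le> c" "gam u m \<le> 51 / 50 * m * u"
      "gam u (c * s * n) \<le> 51 / 50 * (c * s * n) * u"
    and lower: "\<And>v. l * norm v \<le> norm (L *v v)"
    and cond: "spectral_norm L * ((51 / 2) * t + (51 / 2) * c * s * n * sqrt n * u * (b + t)) \<le> a * l"
  shows "9552 / 10000 * a * norm (L *v v) \<le> norm (Y0 *v v)"
    and "norm (Y0 *v v) \<le> 10453 / 10000 * b * norm (L *v v)"
proof -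
  define x where "x = spectral_norm L"
  have nn: "0 \<le> m" "0 \<le> n" "0 \<le> s" "0 \<le> x" by (simp_all add: m_def n_def s_def x_def spectral_norm_nonneg)
  then have t: "0 \<le> t" using u by (simp add: t_def)
  obtain D where D: "Ls = Om ** L + D" "\<bar>D\<bar> \<le> gam u m *\<^sub>R (\<bar>Om\<bar> ** \<bar>L\<bar>)"
    using Ls by (auto simp: product_computed_def m_def)
  obtain E where E: "H ** Y0 = Ls + E" "norm E \<le> gam u (c * s * n) * norm Ls"
    and H: "norm (transpose H ** H - mat 1) \<le> 1 / 100"
    using qr by (auto simp: householder_qr_computed_def n_def s_def)
  have nL: "norm L \<le> sqrt n * x"
    using norm_le_sqrt_spectral_norm[of L] by (simp add: n_def x_def)
  have "norm D \<le> 51 / 50 * m * u * (norm Om * norm L)"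
    by (rule norm_abs_le_product[OF D(2)]) (use u nn in auto)
  also have "\<dots> \<le> 51 / 50 * m * u * (norm Om * (sqrt n * x))"
    using nL u nn by (intro mult_left_mono) auto
  finally have d: "norm D \<le> t * x" by (simp add: t_def mult_ac)
  have "norm (Ls *v v) \<le> (b + t) * x * norm v" for v
  proof -
    have "b * norm (L *v v) \<le> b * (x * norm v)"
      using norm_mult_vec_le_onorm[of L v] ab unfolding x_def by (intro mult_left_mono) auto
    with embed(2)[of v] have "norm (Om *v (L *v v)) \<le> b * (x * norm v)"
      by (rule order_trans)
    moreover have "norm (D *v v) \<le> t * x * norm v"
      using norm_mult_vec_le[of D v] d by (meson mult_right_mono norm_ge_zero order_trans)
    ultimately show ?thesis
      using norm_triangle_ineq[of "Om *v (L *v v)" "D *v v"]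
      by (simp add: D(1) matrix_vector_mult_add_rdistrib matrix_vector_mul_assoc algebra_simps)
  qed
  then have "spectral_norm Ls \<le> (b + t) * x" by (rule spectral_norm_leI)
  then have "sqrt n * spectral_norm Ls \<le> sqrt n * ((b + t) * x)"
    using nn by (intro mult_left_mono) auto
  with norm_le_sqrt_spectral_norm[of Ls, folded n_def]
  have nLs: "norm Ls \<le> sqrt n * ((b + t) * x)" by (rule order_trans)
  have "norm E \<le> 51 / 50 * (c * s * n) * u * norm Ls"
    using E(2) u(4) by (meson mult_right_mono norm_ge_zero order_trans)
  also have "\<dots> \<le> 51 / 50 * (c * s * n) * u * (sqrt n * ((b + t) * x))"
    using nLs u nn by (intro mult_left_mono) auto
  finally have e: "norm E \<le> 51 / 50 * (c * s * n * sqrt n * u * (b + t) * x)" by (simp add: mult_ac)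
  have "51 / 2 * (t * x) + (51 / 2) * (c * s * n * sqrt n * u * (b + t) * x) \<le> a * l"
    using cond by (simp add: x_def algebra_simps add_divide_distrib)
  moreover have "0 \<le> t * x" using t nn by simp
  ultimately have de: "norm D + norm E \<le> 4 / 100 * (a * l)" using d e by linarith
  have err: "norm ((D + E) *v v) \<le> 4 / 100 * (a * norm (L *v v))"
  proof -
    have "norm ((D + E) *v v) \<le> norm (D + E) * norm v" by (rule norm_mult_vec_le)
    also have "\<dots> \<le> 4 / 100 * (a * l) * norm v"
      using de norm_triangle_ineq[of D E] by (intro mult_right_mono) auto
    also have "\<dots> = 4 / 100 * (a * (l * norm v))" by simp
    also have "\<dots> \<le> 4 / 100 * (a * norm (L *v v))"
      using lower ab by (intro mult_left_mono) auto
    finally show ?thesis .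
  qed
  have HY: "H *v (Y0 *v v) = Om *v (L *v v) + (D + E) *v v"
    by (simp add: matrix_vector_mul_assoc E(1) D(1) matrix_vector_mult_add_rdistrib)
  have aL: "0 \<le> a * norm (L *v v)" "a * norm (L *v v) \<le> b * norm (L *v v)"
    using ab by (auto intro: mult_right_mono)
  note bounds = embed[of v] err norm_triangle_ineq[of "Om *v (L *v v)" "(D + E) *v v"]
    norm_triangle_ineq4[of "H *v (Y0 *v v)" "(D + E) *v v"]
  have up: "norm (H *v (Y0 *v v)) \<le> 104 / 100 * (b * norm (L *v v))"
    using bounds aL HY by simp
  have lo: "96 / 100 * (a * norm (L *v v)) \<le> norm (H *v (Y0 *v v))"
    using bounds aL HY by simp
  show "9552 / 10000 * a * norm (L *v v) \<le> norm (Y0 *v v)"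
    using lo near_isometry_bounds(2)[OF H, of "Y0 *v v"] aL by simp
  show "norm (Y0 *v v) \<le> 10453 / 10000 * b * norm (L *v v)"
    using up near_isometry_bounds(1)[OF H, of "Y0 *v v"] aL by simp
qed

lemma lower_bound_mult:
  fixes L :: "real^'n^'m" and U :: "real^'n^'n"
  assumes "\<And>v. l * norm v \<le> norm (L *v v)" "\<And>v. k * norm v \<le> norm (U *v v)" "0 \<le> l"
  shows "l * k * norm v \<le> norm (L *v (U *v v))"
proof -
  have "l * (k * norm v) \<le> l * norm (U *v v)" using assms by (intro mult_left_mono)
  with assms(1)[of "U *v v"] show ?thesis by simp
qed

text \<open>The error of the product Y0 U is at most 1.02 * 1.0453 / 23.6 < 0.0452 relative to a |L
  U v|. This is subtracted from 0.9552 and added to 1.0453.\<close>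

lemma preconditioner_bounds:
  fixes L :: "real^'n::{finite,linorder}^'m" and U Y0 Y1 :: "real^'n::{finite,linorder}^'n::{finite,linorder}"
    and a b l k u :: real
  defines "n \<equiv> real CARD('n)"
  assumes Y0: "\<And>v. (9552 / 10000) * a * norm (L *v v) \<le> norm (Y0 *v v)"
      "\<And>v. norm (Y0 *v v) \<le> 10453 / 10000 * b * norm (L *v v)"
    and ab: "0 < a" "a \<le> b"
    and Y1: "product_computed u Y0 U Y1"
    and u: "0 \<le> u" "gam u n \<le> 51 / 50 * n * u"
    and lower: "\<And>v. l * norm v \<le> norm (L *v v)" "\<And>v. k * norm v \<le> norm (U *v v)" "0 \<le> l"
    and cond: "spectral_norm L * spectral_norm U * ((118 / 5) * n\<^sup>2 * u * b) \<le> a * (l * k)"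
  shows "91 / 100 * a * norm (L *v (U *v v)) \<le> norm (Y1 *v v)"
    and "norm (Y1 *v v) \<le> 10905 / 10000 * b * norm (L *v (U *v v))"
proof -
  define x where "x = spectral_norm L"
  define y where "y = spectral_norm U"
  have nn: "0 \<le> n" "0 \<le> x" "0 \<le> y" by (simp_all add: n_def x_def y_def spectral_norm_nonneg)
  have "norm (Y0 *v v) \<le> 10453 / 10000 * b * x * norm v" for v
  proof -
    have "b * norm (L *v v) \<le> b * (x * norm v)"
      unfolding x_def using norm_mult_vec_le_onorm ab by (intro mult_left_mono) auto
    then show ?thesis using Y0(2)[of v] by simp
  qed
  then have Y0x: "spectral_norm Y0 \<le> 10453 / 10000 * b * x" by (rule spectral_norm_leI)
  obtain D where D: "Y1 = Y0 ** U + D" "\<bar>D\<bar> \<le> gam u n *\<^sub>R (\<bar>Y0\<bar> ** \<bar>U\<bar>)"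
    using Y1 by (auto simp: product_computed_def n_def)
  have "norm D \<le> 51 / 50 * n * u * (norm Y0 * norm U)"
    by (rule norm_abs_le_product[OF D(2)]) (use u nn in auto)
  from norm_le_bound_product(2)[OF this]
  have "norm D \<le> 51 / 50 * n * u * (n * (spectral_norm Y0 * y))"
    using u nn by (simp add: n_def y_def)
  also have "\<dots> \<le> 51 / 50 * n * u * (n * ((10453 / 10000) * b * x * y))"
    using u nn Y0x by (intro mult_left_mono mult_right_mono) auto
  also have "\<dots> = 51 / 50 * (10453 / 10000) / (118 / 5) * (x * y * ((118 / 5) * n\<^sup>2 * u * b))"
    by (simp add: power2_eq_square)
  also have "\<dots> \<le> 51 / 50 * (10453 / 10000) / (118 / 5) * (a * (l * k))"
    using cond by (intro mult_left_mono) (auto simp: x_def y_def)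
  finally have d: "norm D \<le> 51 / 50 * (10453 / 10000) / (118 / 5) * (a * (l * k))" .
  let ?z = "norm (L *v (U *v v))"
  have az: "0 \<le> a * ?z" "a * ?z \<le> b * ?z" using ab by (auto intro: mult_right_mono)
  have "norm (D *v v) \<le> norm D * norm v" by (rule norm_mult_vec_le)
  also have "\<dots> \<le> 51 / 50 * (10453 / 10000) / (118 / 5) * (a * (l * k)) * norm v"
    using d by (intro mult_right_mono) auto
  also have "\<dots> = 51 / 50 * (10453 / 10000) / (118 / 5) * (a * (l * k * norm v))" by simp
  also have "\<dots> \<le> 51 / 50 * (10453 / 10000) / (118 / 5) * (a * ?z)"
    using lower_bound_mult[of l L k U v] lower ab by (intro mult_left_mono) auto
  also have "\<dots> \<le> 452 / 10000 * (a * ?z)" using az by simp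
  finally have err: "norm (D *v v) \<le> 452 / 10000 * (a * ?z)" .
  have Yv: "Y1 *v v = Y0 *v (U *v v) + D *v v"
    by (simp add: matrix_vector_mul_assoc D(1) matrix_vector_mult_add_rdistrib)
  note bounds = Y0[of "U *v v"] err norm_triangle_ineq[of "Y0 *v (U *v v)" "D *v v"]
    norm_triangle_ineq4[of "Y1 *v v" "D *v v"]
  show "91 / 100 * a * ?z \<le> norm (Y1 *v v)"
    using bounds az Yv by simp
  show "norm (Y1 *v v) \<le> 10905 / 10000 * b * ?z"
    using bounds az Yv by simp
qed

section \<open>The product of the computed LU factors compared with \<open>X\<close>\<close>

lemma norm_permutation_matrix_mult:
  fixes P :: "real^'m^'m"
  assumes "permutation_matrix P"
  shows "norm (P *v x) = norm x"
proof -
  obtain \<pi> where \<pi>: "bij \<pi>" "P = (\<chi> i j. if j = \<pi> i then 1 else 0)"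
    using assms by (auto simp: permutation_matrix_def)
  have "(P *v x) $ i = x $ \<pi> i" for i
    by (simp add: \<pi>(2) matrix_vector_mult_def if_distrib[of "\<lambda>c. c * _"] cong: if_cong)
  then have "(\<Sum>i\<in>UNIV. (norm ((P *v x) $ i))\<^sup>2) = (\<Sum>i\<in>UNIV. (norm (x $ \<pi> i))\<^sup>2)"
    by simp
  also have "\<dots> = (\<Sum>i\<in>UNIV. (norm (x $ i))\<^sup>2)"
    using sum.reindex_bij_betw[OF \<pi>(1), of "\<lambda>i. (norm (x $ i))\<^sup>2"] by simp
  finally show ?thesis by (simp add: norm_vec_def L2_set_def)
qed

text \<open>A permutation preserves lengths, so only the factorization error separates |X v| from |L
  U v|; relative to |L U v| it is at most 1.02 / 23.6 < 0.0433.\<close>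

lemma lu_bounds:
  fixes X L :: "real^'n::{finite,linorder}^'m::{finite,linorder}" and U :: "real^'n::{finite,linorder}^'n::{finite,linorder}"
    and P :: "real^'m::{finite,linorder}^'m::{finite,linorder}" and a b l k u :: real
  defines "n \<equiv> real CARD('n)"
  assumes lu: "lu_computed u X P L U"
    and ab: "0 < a" "a \<le> b"
    and u: "0 \<le> u" "gam u n \<le> 51 / 50 * n * u"
    and lower: "\<And>v. l * norm v \<le> norm (L *v v)" "\<And>v. k * norm v \<le> norm (U *v v)" "0 \<le> l" "0 \<le> k"
    and cond: "spectral_norm L * spectral_norm U * ((118 / 5) * n\<^sup>2 * u * b) \<le> a * (l * k)"
  shows "9567 / 10000 * norm (L *v (U *v v)) \<le> norm (X *v v)"
    and "norm (X *v v) \<le> 10433 / 10000 * norm (L *v (U *v v))"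
proof -
  define x where "x = spectral_norm L"
  define y where "y = spectral_norm U"
  have nn: "0 \<le> n" "0 \<le> x" "0 \<le> y" by (simp_all add: n_def x_def y_def spectral_norm_nonneg)
  \<comment> \<open>Raising \<open>a\<close> to \<open>b\<close> on the right lets \<open>b\<close>
    cancel and leaves a restriction free of both.\<close>
  have "a * (l * k) \<le> b * (l * k)" using ab lower by (intro mult_right_mono) auto
  with cond have "b * (x * y * ((118 / 5) * n\<^sup>2 * u)) \<le> b * (l * k)"
    by (simp add: x_def y_def mult_ac)
  then have cond': "x * y * ((118 / 5) * n\<^sup>2 * u) \<le> l * k" using ab by simp
  obtain D where D: "L ** U = P ** X + D" "\<bar>D\<bar> \<le> gam u n *\<^sub>R (\<bar>L\<bar> ** \<bar>U\<bar>)"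
    and P: "permutation_matrix P"
    using lu by (auto simp: lu_computed_def n_def)
  have "norm D \<le> 51 / 50 * n * u * (norm L * norm U)"
    by (rule norm_abs_le_product[OF D(2)]) (use u nn in auto)
  from norm_le_bound_product(2)[OF this]
  have "norm D \<le> 51 / 50 * n * u * (n * (x * y))"
    using u nn by (simp add: n_def y_def x_def)
  also have "\<dots> = (51 / 50) / (118 / 5) * (x * y * ((118 / 5) * n\<^sup>2 * u))"
    by (simp add: power2_eq_square)
  also have "\<dots> \<le> (51 / 50) / (118 / 5) * (l * k)"
    using cond' by (intro mult_left_mono) auto
  finally have d: "norm D \<le> (51 / 50) / (118 / 5) * (l * k)" .
  let ?z = "norm (L *v (U *v v))"
  have "norm (D *v v) \<le> norm D * norm v" by (rule norm_mult_vec_le)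
  also have "\<dots> \<le> (51 / 50) / (118 / 5) * (l * k) * norm v"
    using d by (intro mult_right_mono) auto
  also have "\<dots> = (51 / 50) / (118 / 5) * (l * k * norm v)" by simp
  also have "\<dots> \<le> (51 / 50) / (118 / 5) * ?z"
    using lower_bound_mult[of l L k U v] lower by (intro mult_left_mono) auto
  also have "\<dots> \<le> 433 / 10000 * ?z" by simp
  finally have err: "norm (D *v v) \<le> 433 / 10000 * ?z" .
  have LU: "L *v (U *v v) = P *v (X *v v) + D *v v"
    by (simp add: matrix_vector_mul_assoc D(1) matrix_vector_mult_add_rdistrib)
  have PX: "norm (P *v (X *v v)) = norm (X *v v)"
    by (rule norm_permutation_matrix_mult[OF P])
  note bounds = err PX norm_triangle_ineq[of "P *v (X *v v)" "D *v v"]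
    norm_triangle_ineq4[of "L *v (U *v v)" "D *v v"]
  show "9567 / 10000 * ?z \<le> norm (X *v v)"
    using bounds LU by simp
  show "norm (X *v v) \<le> 10433 / 10000 * ?z"
    using bounds LU by simp
qed

text \<open>\<open>Y1\<close> and \<open>X\<close> are each compared pointwise with L U, hence with
  each other: 1.0905 / 0.9567 < 1.14 and 1.0433 / 0.91 < 1.147. As \<open>W\<close> is X Y1^-1 up to
  the solve error, these ratios bound its singular values.\<close>

lemma preconditioned_bounds:
  fixes X L W :: "real^'n::{finite,linorder}^'m::{finite,linorder}" and U Y1 :: "real^'n::{finite,linorder}^'n::{finite,linorder}"
    and a b l k u :: real
  defines "n \<equiv> real CARD('n)"
  assumes Y1: "\<And>v. (91 / 100) * a * norm (L *v (U *v v)) \<le> norm (Y1 *v v)"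
      "\<And>v. norm (Y1 *v v) \<le> 10905 / 10000 * b * norm (L *v (U *v v))"
    and X: "\<And>v. (9567 / 10000) * norm (L *v (U *v v)) \<le> norm (X *v v)"
      "\<And>v. norm (X *v v) \<le> 10433 / 10000 * norm (L *v (U *v v))"
    and solve: "row_solve_computed u Y1 X W"
    and ab: "0 < a" "a \<le> b"
    and u: "0 \<le> u" "gam u n \<le> 51 / 50 * n * u"
    and lower: "\<And>v. l * norm v \<le> norm (L *v v)" "\<And>v. k * norm v \<le> norm (U *v v)" "0 < l" "0 < k"
    and cond: "spectral_norm L * spectral_norm U * ((118 / 5) * n\<^sup>2 * u * b) \<le> a * (l * k)"
  obtains D where "W ** Y1 = X + D" "norm D \<le> 51 / 50 * n * u * (norm W * norm Y1)"
    "\<And>v. norm (Y1 *v v) \<le> 114 / 100 * b * norm (X *v v)"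
    "spectral_norm W \<le> (121 / 100) / a"
    "\<And>w. ((877 / 1000) / b - (63 / 1000) / a) * norm w \<le> norm (W *v w)"
proof -
  define x where "x = spectral_norm L"
  define y where "y = spectral_norm U"
  define z where "z = spectral_norm W"
  have nn: "0 \<le> n" "0 \<le> x" "0 \<le> y" "0 \<le> z" by (simp_all add: n_def x_def y_def z_def spectral_norm_nonneg)
  have low: "l * k * norm v \<le> norm (L *v (U *v v))" for v
    using lower by (intro lower_bound_mult) auto
  have YX: "norm (Y1 *v v) \<le> 114 / 100 * b * norm (X *v v)" for v
  proof -
    have "b * ((9567 / 10000) * norm (L *v (U *v v))) \<le> b * norm (X *v v)"
      using X ab by (intro mult_left_mono) auto
    moreover have "0 \<le> b * norm (X *v v)" using ab by simp
    ultimately show ?thesis using Y1(2)[of v] by simp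
  qed
  have XY: "norm (X *v v) \<le> (1147 / 1000) / a * norm (Y1 *v v)" for v
  proof -
    have "a * norm (X *v v) \<le> 10433 / 10000 * (a * norm (L *v (U *v v)))"
      using mult_left_mono[OF X(2)[of v], of a] ab by simp
    then have "a * norm (X *v v) \<le> 1147 / 1000 * norm (Y1 *v v)"
      using Y1(1)[of v] norm_ge_zero[of "Y1 *v v"] by linarith
    then show ?thesis using ab by (simp add: field_simps)
  qed
  have "norm (Y1 *v v) \<le> 10905 / 10000 * b * (x * y) * norm v" for v
  proof -
    have "norm (L *v (U *v v)) \<le> x * norm (U *v v)"
      unfolding x_def by (rule norm_mult_vec_le_onorm)
    also have "\<dots> \<le> x * (y * norm v)"
      unfolding y_def by (rule mult_left_mono[OF norm_mult_vec_le_onorm nn(2)])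
    finally have "norm (L *v (U *v v)) \<le> x * y * norm v" by simp
    then have "b * norm (L *v (U *v v)) \<le> b * (x * y * norm v)"
      using ab by (intro mult_left_mono) auto
    then show ?thesis using Y1(2)[of v] by simp
  qed
  then have Y1xy: "spectral_norm Y1 \<le> 10905 / 10000 * b * (x * y)" by (rule spectral_norm_leI)
  obtain D where D: "W ** Y1 = X + D" "\<bar>D\<bar> \<le> gam u n *\<^sub>R (\<bar>W\<bar> ** \<bar>Y1\<bar>)"
    using row_solve_backward_error[OF solve] n_def by metis
  have nD: "norm D \<le> 51 / 50 * n * u * (norm W * norm Y1)"
    by (rule norm_abs_le_product[OF D(2)]) (use u nn in auto)
  from norm_le_bound_product(2)[OF this]
  have "norm D \<le> 51 / 50 * n * u * (n * (z * spectral_norm Y1))"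
    using u nn by (simp add: n_def z_def)
  also have "\<dots> \<le> 51 / 50 * n * u * (n * (z * ((10905 / 10000) * b * (x * y))))"
    using u nn Y1xy by (intro mult_left_mono) auto
  also have "\<dots> = 51 / 50 * (10905 / 10000) / (118 / 5) * z * (x * y * ((118 / 5) * n\<^sup>2 * u * b))"
    by (simp add: power2_eq_square)
  also have "\<dots> \<le> 51 / 50 * (10905 / 10000) / (118 / 5) * z * (a * (l * k))"
    using cond nn by (intro mult_left_mono) (auto simp: x_def y_def)
  finally have d: "norm D \<le> 51 / 50 * (10905 / 10000) / (118 / 5) * z * (a * (l * k))" .
  have Dv: "norm (D *v v) \<le> 518 / 10000 * z * norm (Y1 *v v)" for v
  proof -
    have "norm (D *v v) \<le> norm D * norm v" by (rule norm_mult_vec_le)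
    also have "\<dots> \<le> 51 / 50 * (10905 / 10000) / (118 / 5) * z * (a * (l * k)) * norm v"
      using d by (intro mult_right_mono) auto
    also have "\<dots> = 51 / 50 * (10905 / 10000) / (118 / 5) * z * (a * (l * k * norm v))" by simp
    also have "\<dots> \<le> 51 / 50 * (10905 / 10000) / (118 / 5) * z * (a * norm (L *v (U *v v)))"
      using low ab nn by (intro mult_left_mono) auto
    also have "\<dots> \<le> 51 / 50 * (10905 / 10000) / (118 / 5) * z * (norm (Y1 *v v) / (91 / 100))"
      using Y1(1)[of v] nn by (intro mult_left_mono) auto
    also have "\<dots> = 51 / 50 * (10905 / 10000) / (118 / 5) / (91 / 100) * (z * norm (Y1 *v v))" by simp
    also have "\<dots> \<le> 518 / 10000 * (z * norm (Y1 *v v))" using nn by (intro mult_right_mono) auto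
    finally show ?thesis by simp
  qed
  have "91 / 100 * (a * (l * k)) * norm v \<le> norm (Y1 *v v)" for v
  proof -
    have "a * (l * k * norm v) \<le> a * norm (L *v (U *v v))" using low ab by (intro mult_left_mono) auto
    then show ?thesis using Y1(1)[of v] by simp
  qed
  then obtain B where B: "Y1 ** B = mat 1"
    by (rule injective_matrix_inverse) (use ab lower in auto)
  have Ww: "W *v w = X *v (B *v w) + D *v (B *v w)" and Yw: "Y1 *v (B *v w) = w" for w
  proof -
    have "W *v w = (W ** Y1) *v (B *v w)"
      by (metis B(1) matrix_vector_mul_assoc matrix_vector_mul_lid)
    then show "W *v w = X *v (B *v w) + D *v (B *v w)"
      by (simp add: D(1) matrix_vector_mult_add_rdistrib)
    show "Y1 *v (B *v w) = w" by (simp add: matrix_vector_mul_assoc B(1))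
  qed
  have "norm (W *v w) \<le> ((1147 / 1000) / a + (518 / 10000) * z) * norm w" for w
    using norm_triangle_ineq[of "X *v (B *v w)" "D *v (B *v w)"] XY[of "B *v w"] Dv[of "B *v w"]
    unfolding Ww Yw by (simp only: distrib_right)
  \<comment> \<open>The solve error is proportional to \<open>z\<close>, so the estimate is solved
    for \<open>z\<close>: 1.147 / (1 - 0.0518) < 1.21.\<close>
  then have "z \<le> (1147 / 1000) / a + (518 / 10000) * z" unfolding z_def by (rule spectral_norm_leI)
  then have "z \<le> (1147 / 1000) / (1 - 518 / 10000) * (1 / a)" by simp
  also have "\<dots> \<le> 121 / 100 * (1 / a)" using ab by (intro mult_right_mono) auto
  finally have z: "z \<le> 121 / 100 * (1 / a)" .
  \<comment> \<open>0.877 < 1 / 1.14 comes from the exact part. The solve error carries the norm of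
    \<open>W\<close> and is charged to 1/a, with 0.0518 * 1.21 < 0.063.\<close>
  have "((877 / 1000) / b - (63 / 1000) / a) * norm w \<le> norm (W *v w)" for w
  proof -
    have "norm w \<le> 114 / 100 * b * norm (X *v (B *v w))" using YX[of "B *v w"] by (simp add: Yw)
    then have "norm w / b \<le> 114 / 100 * norm (X *v (B *v w))" using ab by (simp add: field_simps)
    moreover have "norm (D *v (B *v w)) \<le> 518 / 10000 * ((121 / 100) * (1 / a)) * norm w"
      using Dv[of "B *v w"] z mult_right_mono[OF z, of "norm w"] by (simp add: Yw)
    moreover have "norm (X *v (B *v w)) \<le> norm (W *v w) + norm (D *v (B *v w))"
      using norm_triangle_ineq4[of "W *v w" "D *v (B *v w)"] by (simp add: Ww)
    moreover have "0 \<le> norm w / b" "0 \<le> norm w / a" using ab by auto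
    ultimately have "877 / 1000 * (norm w / b) - (63 / 1000) * (norm w / a) \<le> norm (W *v w)"
      by simp
    then show ?thesis by (simp add: algebra_simps)
  qed
  with D(1) nD YX z show ?thesis unfolding z_def by (intro that) auto
qed

section \<open>Two Cholesky QR steps and the residual\<close>

text \<open>The second step starts from \<open>V\<close>, with 1.021 and 0.979 as \<open>h\<close>
  and \<open>l\<close>. Hence 3.3 (1.021 / 0.979)^2 < 6 bounds the loss of orthogonality, whatever
  the conditioning of \<open>W\<close>.\<close>

lemma cholesky_qr2_bounds:
  fixes X W V Q :: "real^'n::{finite,linorder}^'m"
    and Y1 Y2 Y3 Y4 G1 G2 R :: "real^'n::{finite,linorder}^'n::{finite,linorder}" and u h l \<beta> :: real
  defines "m \<equiv> real CARD('m)" and "n \<equiv> real CARD('n)"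
  defines "\<delta> \<equiv> m * n * u + n * (n + 1) * u"
  assumes W: "W ** Y1 = X + Dx" "norm Dx \<le> 51 / 50 * n * u * (norm W * norm Y1)"
    and Y1: "\<And>v. norm (Y1 *v v) \<le> \<beta> * norm (X *v v)" "0 \<le> \<beta>"
    and first: "product_computed u (transpose W) W G1" "cholesky_computed u G1 Y2" "row_solve_computed u Y2 W V"
    and Y3: "product_computed u Y2 Y1 Y3"
    and second: "product_computed u (transpose V) V G2" "cholesky_computed u G2 Y4" "row_solve_computed u Y4 V Q"
    and R: "product_computed u Y4 Y3 R"
    and u: "0 \<le> u" "gam u m \<le> 51 / 50 * m * u" "gam u n \<le> 51 / 50 * n * u"
      "gam u (n + 1) \<le> 51 / 50 * (n + 1) * u"
    and upper: "spectral_norm W \<le> h" and lower: "\<And>v. l * norm v \<le> norm (W *v v)" and l: "0 < l"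
    and small: "\<delta> * (h / l)\<^sup>2 \<le> 1 / 80" "\<delta> \<le> 1 / 100"
  shows "norm (transpose Q ** Q - mat 1) \<le> 6 * \<delta>"
    and "norm (Q ** R - X) \<le> \<beta> * h * ((3181 / 1000) * (n * sqrt n * u * norm X)
           + (2161 / 1000) * (n\<^sup>2 * u * spectral_norm X))"
proof -
  have mn: "0 \<le> m" "1 \<le> n" by (simp_all add: m_def n_def Suc_le_eq)
  have \<delta>0: "0 \<le> \<delta>" using mn u by (simp add: \<delta>_def)
  have h: "0 \<le> h" using upper spectral_norm_nonneg[of W] by linarith
  obtain D3 where D3: "V ** Y2 = W + D3" "norm D3 \<le> 51 / 50 * n * u * (norm V * norm Y2)"
    and Y2: "spectral_norm Y2 \<le> 1013 / 1000 * h" and V: "spectral_norm V \<le> 1021 / 1000"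
      "\<And>w. (979 / 1000) * norm w \<le> norm (V *v w)"
    using cholesky_qr_step[OF first u[unfolded m_def n_def] upper lower l small(1)[unfolded \<delta>_def m_def n_def]]
    unfolding n_def by blast
  have small': "\<delta> * ((1021 / 1000) / (979 / 1000))\<^sup>2 \<le> 1 / 80"
    using small(2) by (simp add: power2_eq_square)
  obtain D7 where D7: "Q ** Y4 = V + D7" "norm D7 \<le> 51 / 50 * n * u * (norm Q * norm Y4)"
    and Y4: "spectral_norm Y4 \<le> 1013 / 1000 * (1021 / 1000)" and Q: "spectral_norm Q \<le> 1021 / 1000"
    and orth: "norm (transpose Q ** Q - mat 1) \<le> 33 / 10 * \<delta> * ((1021 / 1000) / (979 / 1000))\<^sup>2"
    using cholesky_qr_step[OF second u[unfolded m_def n_def] V _ small'[unfolded \<delta>_def m_def n_def]]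
    unfolding n_def m_def \<delta>_def by (metis divide_pos_pos zero_less_numeral)
  have "33 / 10 * \<delta> * ((1021 / 1000) / (979 / 1000))\<^sup>2 \<le> 6 * \<delta>"
    using \<delta>0 by (simp add: power2_eq_square)
  with orth show "norm (transpose Q ** Q - mat 1) \<le> 6 * \<delta>" by (rule order_trans)

  define \<xi> where "\<xi> = spectral_norm X"
  define \<nu> where "\<nu> = norm X"
  have nn: "0 \<le> \<xi>" "0 \<le> \<nu>" by (simp_all add: \<xi>_def \<nu>_def spectral_norm_nonneg)
  define f where "f = n * sqrt n * u"
  define g where "g = n\<^sup>2 * u"
  have fg: "0 \<le> f" "0 \<le> g" using mn u by (simp_all add: f_def g_def)
  have "n * n * u \<le> n * (n + 1) * u" using mn u by (intro mult_right_mono mult_left_mono) auto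
  moreover have "0 \<le> m * n * u" using mn u by simp
  ultimately have g1: "g \<le> 1 / 100" using small(2) by (simp add: g_def \<delta>_def power2_eq_square)
  have "sqrt n \<le> n" using mn by (simp add: sqrt_le_D real_le_lsqrt power2_eq_square)
  then have "n * sqrt n * u \<le> n * n * u" using mn u by (intro mult_right_mono mult_left_mono) auto
  then have f1: "f \<le> 1 / 100" using g1 by (simp add: f_def g_def power2_eq_square)

  have Y1F: "norm Y1 \<le> \<beta> * \<nu>" unfolding \<nu>_def by (rule norm_le_columnwise[OF Y1])
  have "norm (Y1 *v v) \<le> \<beta> * \<xi> * norm v" for v
    using Y1(1)[of v] mult_left_mono[OF norm_mult_vec_le_onorm[of X v] Y1(2)] by (simp add: \<xi>_def)
  then have Y1S: "spectral_norm Y1 \<le> \<beta> * \<xi>" by (rule spectral_norm_leI)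
  obtain D4 where D4: "Y3 = Y2 ** Y1 + D4" "\<bar>D4\<bar> \<le> gam u n *\<^sub>R (\<bar>Y2\<bar> ** \<bar>Y1\<bar>)"
    using Y3 by (auto simp: product_computed_def n_def)
  have D4b: "norm D4 \<le> 51 / 50 * n * u * (norm Y2 * norm Y1)"
    by (rule norm_abs_le_product[OF D4(2)]) (use u mn in auto)
  obtain D8 where D8: "R = Y4 ** Y3 + D8" "\<bar>D8\<bar> \<le> gam u n *\<^sub>R (\<bar>Y4\<bar> ** \<bar>Y3\<bar>)"
    using R by (auto simp: product_computed_def n_def)
  have D8b: "norm D8 \<le> 51 / 50 * n * u * (norm Y4 * norm Y3)"
    by (rule norm_abs_le_product[OF D8(2)]) (use u mn in auto)
  have pos: "0 \<le> h * (\<beta> * \<nu>)" "0 \<le> h * (\<beta> * \<xi>)" using h nn Y1 by simp_all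

  \<comment> \<open>\<open>D4\<close> is estimated twice because \<open>Y3\<close> is needed in both
    norms: the Frobenius norm to bound \<open>D8\<close>, the spectral norm to bound
    \<open>D7 ** Y3\<close>.\<close>
  have D4F: "norm D4 \<le> 51 / 50 * f * ((1013 / 1000) * h * (\<beta> * \<nu>))"
    unfolding f_def n_def by (rule error_norm_le(1)[OF D4b[unfolded n_def] u(1) Y2 Y1F])
  have D4S: "norm D4 \<le> 51 / 50 * g * ((1013 / 1000) * h * (\<beta> * \<xi>))"
    unfolding g_def n_def by (rule error_norm_le(2)[OF D4b[unfolded n_def] u(1) Y2 Y1S])
  have "norm (Y2 ** Y1) \<le> 1013 / 1000 * h * (\<beta> * \<nu>)"
    using norm_matrix_mult_le_left[of Y2 Y1] mult_mono[OF Y2 Y1F] h by simp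
  moreover have "f * (h * (\<beta> * \<nu>)) \<le> 1 / 100 * (h * (\<beta> * \<nu>))"
    using f1 pos by (intro mult_right_mono)
  ultimately have Y3F: "norm Y3 \<le> 1026 / 1000 * (h * (\<beta> * \<nu>))"
    using D4F norm_triangle_ineq[of "Y2 ** Y1" D4] pos unfolding D4(1) by simp
  have "spectral_norm (Y2 ** Y1) \<le> 1013 / 1000 * h * (\<beta> * \<xi>)"
    using spectral_norm_mult_le[of Y2 Y1] mult_mono[OF Y2 Y1S] h
    by (simp add: spectral_norm_nonneg)
  moreover have "spectral_norm Y3 \<le> spectral_norm (Y2 ** Y1) + norm D4"
  proof (rule spectral_norm_leI)
    fix v
    show "norm (Y3 *v v) \<le> (spectral_norm (Y2 ** Y1) + norm D4) * norm v"
      using norm_triangle_ineq[of "(Y2 ** Y1) *v v" "D4 *v v"]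
        norm_mult_vec_le_onorm[of "Y2 ** Y1" v] norm_mult_vec_le[of D4 v]
      unfolding D4(1) by (simp add: matrix_vector_mult_add_rdistrib distrib_right)
  qed
  moreover have "g * (h * (\<beta> * \<xi>)) \<le> 1 / 100 * (h * (\<beta> * \<xi>))"
    using g1 pos by (intro mult_right_mono)
  ultimately have Y3S: "spectral_norm Y3 \<le> 1026 / 1000 * (h * (\<beta> * \<xi>))"
    using D4S pos by simp

  define A where "A = f * (h * (\<beta> * \<nu>))"
  define B where "B = g * (h * (\<beta> * \<xi>))"
  have AB: "0 \<le> A" "0 \<le> B" using pos fg by (simp_all add: A_def B_def)
  have T1: "norm Dx \<le> 51 / 50 * A"
    using error_norm_le(1)[OF W(2)[unfolded n_def] u(1) upper Y1F] by (simp add: A_def f_def n_def)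
  have "norm (V ** D4) \<le> 1021 / 1000 * ((51 / 50) * f * ((1013 / 1000) * h * (\<beta> * \<nu>)))"
    using norm_matrix_mult_le_left[of V D4] mult_mono[OF V(1) D4F] by simp
  then have T3: "norm (V ** D4) \<le> 1055 / 1000 * A" using AB by (simp add: A_def)
  have "norm D3 \<le> 51 / 50 * g * ((1021 / 1000) * ((1013 / 1000) * h))"
    unfolding g_def n_def by (rule error_norm_le(2)[OF D3(2)[unfolded n_def] u(1) V(1) Y2])
  then have "norm D3 * spectral_norm Y1 \<le> 51 / 50 * g * ((1021 / 1000) * ((1013 / 1000) * h)) * (\<beta> * \<xi>)"
    using Y1S fg h by (intro mult_mono) (auto simp: spectral_norm_nonneg)
  then have T2: "norm (D3 ** Y1) \<le> 1055 / 1000 * B"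
    using norm_matrix_mult_le_right[of D3 Y1] AB by (simp add: B_def)
  have "norm D7 \<le> 51 / 50 * g * ((1021 / 1000) * ((1013 / 1000) * (1021 / 1000)))"
    unfolding g_def n_def by (rule error_norm_le(2)[OF D7(2)[unfolded n_def] u(1) Q Y4])
  then have "norm D7 * spectral_norm Y3
      \<le> 51 / 50 * g * ((1021 / 1000) * ((1013 / 1000) * (1021 / 1000))) * ((1026 / 1000) * (h * (\<beta> * \<xi>)))"
    using Y3S fg h by (intro mult_mono) (auto simp: spectral_norm_nonneg)
  then have T4: "norm (D7 ** Y3) \<le> 1106 / 1000 * B"
    using norm_matrix_mult_le_right[of D7 Y3] AB by (simp add: B_def)
  have "norm D8 \<le> 51 / 50 * f * ((1013 / 1000) * (1021 / 1000) * ((1026 / 1000) * (h * (\<beta> * \<nu>))))"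
    unfolding f_def n_def by (rule error_norm_le(1)[OF D8b[unfolded n_def] u(1) Y4 Y3F])
  then have "spectral_norm Q * norm D8
      \<le> 1021 / 1000 * ((51 / 50) * f * ((1013 / 1000) * (1021 / 1000) * ((1026 / 1000) * (h * (\<beta> * \<nu>)))))"
    using Q by (intro mult_mono) auto
  then have T5: "norm (Q ** D8) \<le> 1106 / 1000 * A"
    using norm_matrix_mult_le_left[of Q D8] AB by (simp add: A_def)
  have "Q ** R = (Q ** Y4) ** Y3 + Q ** D8"
    by (simp add: D8(1) matrix_add_ldistrib matrix_mul_assoc)
  also have "(Q ** Y4) ** Y3 = V ** Y3 + D7 ** Y3"
    by (simp add: D7(1) matrix_add_rdistrib)
  also have "V ** Y3 = (V ** Y2) ** Y1 + V ** D4"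
    by (simp add: D4(1) matrix_add_ldistrib matrix_mul_assoc)
  also have "(V ** Y2) ** Y1 = X + Dx + D3 ** Y1"
    by (simp add: D3(1) W(1) matrix_add_rdistrib)
  finally have "Q ** R - X = Dx + D3 ** Y1 + V ** D4 + D7 ** Y3 + Q ** D8" by simp
  also have "norm \<dots> \<le> norm Dx + norm (D3 ** Y1) + norm (V ** D4) + norm (D7 ** Y3) + norm (Q ** D8)"
    by (intro order_trans[OF norm_triangle_ineq] add_mono order_refl)
  \<comment> \<open>\<open>A\<close> gathers \<open>Dx\<close>, \<open>V ** D4\<close> and
    \<open>Q ** D8\<close>, which retain the Frobenius norm of \<open>X\<close>: 1.02 + 1.055 +
    1.106. \<open>B\<close> gathers \<open>D3 ** Y1\<close> and \<open>D7 ** Y3\<close>, whose right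
    factors are measured spectrally: 1.055 + 1.106.\<close>
  also have "\<dots> \<le> 3181 / 1000 * A + (2161 / 1000) * B"
    using T1 T2 T3 T4 T5 by linarith
  finally show "norm (Q ** R - X) \<le> \<beta> * h * ((3181 / 1000) * (n * sqrt n * u * norm X)
           + (2161 / 1000) * (n\<^sup>2 * u * spectral_norm X))"
    by (simp add: A_def B_def f_def g_def \<nu>_def \<xi>_def algebra_simps)
qed

section \<open>The randomized algorithm\<close>

lemma subspace_embedding_bounds:
  assumes "subspace_embedding \<epsilon> Om K" "x \<in> K" "0 \<le> \<epsilon>" "\<epsilon> < 1"
  shows "sqrt (1 - \<epsilon>) * norm x \<le> norm (Om *v x)" "norm (Om *v x) \<le> sqrt (1 + \<epsilon>) * norm x"
proof -
  have "\<bar>x \<bullet> x - (Om *v x) \<bullet> (Om *v x)\<bar> \<le> \<epsilon> * norm x * norm x"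
    using assms by (auto simp: subspace_embedding_def)
  then have *: "\<bar>(norm x)\<^sup>2 - (norm (Om *v x))\<^sup>2\<bar> \<le> \<epsilon> * (norm x)\<^sup>2"
    by (simp add: dot_square_norm power2_eq_square mult.assoc)
  show "sqrt (1 - \<epsilon>) * norm x \<le> norm (Om *v x)"
  proof (rule power2_le_imp_le)
    show "(sqrt (1 - \<epsilon>) * norm x)\<^sup>2 \<le> (norm (Om *v x))\<^sup>2"
      using *[unfolded abs_le_iff] assms by (simp add: power_mult_distrib algebra_simps)
  qed simp
  show "norm (Om *v x) \<le> sqrt (1 + \<epsilon>) * norm x"
  proof (rule power2_le_imp_le)
    show "(norm (Om *v x))\<^sup>2 \<le> (sqrt (1 + \<epsilon>) * norm x)\<^sup>2"
      using *[unfolded abs_le_iff] assms by (simp add: power_mult_distrib algebra_simps)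
  qed (use assms in simp)
qed

text \<open>A finite bound excludes the infinite branch of \<open>cond2\<close>, so linear
  independence of the columns comes with it.\<close>

lemma cond2_le_ereal:
  fixes A :: "real^'n^'m"
  assumes "cond2 A \<le> ereal q"
  shows "0 < singular_value CARD('n) A" "spectral_norm A / singular_value CARD('n) A \<le> q"
proof -
  have nz: "singular_value CARD('n) A \<noteq> 0"
    using assms unfolding cond2_def by (metis PInfty_neq_ereal(1) ereal_infty_less_eq(1))
  then show "0 < singular_value CARD('n) A"
    using singular_value_CARD_bound(1)[of A] by linarith
  show "spectral_norm A / singular_value CARD('n) A \<le> q"
    using assms nz unfolding cond2_def by (simp only: if_False ereal_less_eq)
qed

lemma cond_restrictions_bounds:
  fixes Lh :: "real^'n^'m" and Uh :: "real^'n^'n" and Om :: "real^'m^'s" and u c \<epsilon> :: real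
  defines "m \<equiv> real CARD('m)" and "n \<equiv> real CARD('n)" and "s \<equiv> real CARD('s)"
  defines "t \<equiv> (51 / 50) * m * u * sqrt n * norm Om" and "b \<equiv> sqrt (1 + \<epsilon>)" and "a \<equiv> sqrt (1 - \<epsilon>)"
    and "l \<equiv> singular_value CARD('n) Lh" and "k \<equiv> singular_value CARD('n) Uh"
  assumes restr: "cond_restrictions u c \<epsilon> Lh Uh Om" and "0 < u" "0 < c" "0 \<le> \<epsilon>" "\<epsilon> < 1"
  shows "0 < l" "0 < k"
    and "spectral_norm Lh * ((51 / 2) * t + (51 / 2) * c * s * n * sqrt n * u * (b + t)) \<le> a * l"
    and "spectral_norm Lh * spectral_norm Uh * ((118 / 5) * n\<^sup>2 * u * b) \<le> a * (l * k)"
proof -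
  define d where "d = max (spectral_norm Om) 1"
  define r where "r = 51 / 2 * t + (51 / 2) * c * s * n * sqrt n * u * (b + t)"
  define r' where "r' = 118 / 5 * d * n\<^sup>2 * u * (b + t)"
  have mn: "0 < m" "0 < n" "0 < s" by (simp_all add: m_def n_def s_def)
  have t: "0 \<le> t" using mn assms by (simp add: t_def)
  have b: "0 < b" using assms by (simp add: b_def)
  have bt: "0 < b + t" using b t by simp
  have r: "0 < r" unfolding r_def using mn t bt assms by (intro add_nonneg_pos) auto
  have r': "0 < r'" unfolding r'_def using mn bt assms by (simp add: d_def)
  have c: "cond2 Lh \<le> ereal (a / r)" "cond2 Lh * cond2 Uh \<le> ereal (a / r')"
    using restr unfolding cond_restrictions_def Let_def r_def r'_def t_def b_def a_def m_def n_def s_def d_def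
    by simp_all
  show l: "0 < l" using cond2_le_ereal[OF c(1)] by (simp add: l_def)
  have "spectral_norm Lh / l \<le> a / r" using cond2_le_ereal[OF c(1)] by (simp add: l_def)
  then have "spectral_norm Lh * r \<le> a * l" using l r by (simp add: field_simps)
  then show "spectral_norm Lh * ((51 / 2) * t + (51 / 2) * c * s * n * sqrt n * u * (b + t)) \<le> a * l"
    by (simp add: r_def)
  \<comment> \<open>In \<open>ereal\<close>, 0 times infinity is 0. Only a positive norm of
    \<open>Lh\<close> lets the product restriction rule out an infinite
    \<open>cond2 Uh\<close>.\<close>
  have "l * norm (axis undefined 1 :: real^'n) \<le> norm (Lh *v axis undefined 1)"
    unfolding l_def by (rule singular_value_CARD_bound)
  also have "\<dots> \<le> spectral_norm Lh * norm (axis undefined 1 :: real^'n)" by (rule norm_mult_vec_le_onorm)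
  finally have NL: "0 < spectral_norm Lh" using l by simp
  have cL: "cond2 Lh = ereal (spectral_norm Lh / l)" using l by (auto simp: cond2_def l_def)
  have "singular_value CARD('n) Uh \<noteq> 0"
  proof
    assume "singular_value CARD('n) Uh = 0"
    then have "cond2 Lh * cond2 Uh = \<infinity>"
      using cL NL l by (simp add: cond2_def)
    with c(2) show False by simp
  qed
  then show k: "0 < k" using singular_value_CARD_bound(1)[of Uh] by (simp add: k_def)
  then have "cond2 Uh = ereal (spectral_norm Uh / k)" by (auto simp: cond2_def k_def)
  with c(2) cL have "spectral_norm Lh / l * (spectral_norm Uh / k) \<le> a / r'" by simp
  then have "spectral_norm Lh * spectral_norm Uh * r' \<le> a * (l * k)"
    using l k r' by (simp add: field_simps)
  \<comment> \<open>Since d >= 1 and t >= 0, \<open>r'\<close> dominates the simpler quantity in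
    which the rounding lemmas are stated.\<close>
  moreover have "118 / 5 * n\<^sup>2 * u * b \<le> r'"
  proof -
    have "1 * b \<le> d * (b + t)" using t b by (intro mult_mono) (auto simp: d_def)
    then have "118 / 5 * n\<^sup>2 * u * (1 * b) \<le> 118 / 5 * n\<^sup>2 * u * (d * (b + t))"
      using mn assms by (intro mult_left_mono) auto
    then show ?thesis by (simp add: r'_def mult_ac)
  qed
  ultimately show "spectral_norm Lh * spectral_norm Uh * ((118 / 5) * n\<^sup>2 * u * b) \<le> a * (l * k)"
    using NL by (meson mult_left_mono mult_nonneg_nonneg order_less_imp_le order_trans spectral_norm_nonneg)
qed

text \<open>Solved for \<eta>, the hypothesis reads \<eta> < sqrt ((1 - \<epsilon>) / (1 +
  \<epsilon>)). The first entry of the maximum then controls \<delta> against the conditioning of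
  \<open>W\<close>, and the last one keeps later denominators positive.\<close>

lemma eta_bounds:
  assumes "0 \<le> \<epsilon>" "\<epsilon> < 1" "\<epsilon> < (1 - (eta u m n)\<^sup>2) / (1 + (eta u m n)\<^sup>2)"
  shows "64 / 5 * sqrt (m * n * u + n * (n + 1) * u) + 1 / 10 < sqrt (1 - \<epsilon>) / sqrt (1 + \<epsilon>)"
    and "105 / 1000 < sqrt (1 - \<epsilon>) / sqrt (1 + \<epsilon>)"
proof -
  define \<eta> where "\<eta> = eta u m n"
  have le: "64 / 5 * sqrt (m * n * u + n * (n + 1) * u) + 1 / 10 \<le> \<eta>" "105 / 1000 \<le> \<eta>"
    by (auto simp: \<eta>_def eta_def le_max_iff_disj)
  have "0 < 1 + \<eta>\<^sup>2" by (simp add: add_pos_nonneg)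
  then have "\<epsilon> * (1 + \<eta>\<^sup>2) < 1 - \<eta>\<^sup>2" using assms(3) by (simp add: \<eta>_def field_simps)
  then have "\<eta>\<^sup>2 * (1 + \<epsilon>) < 1 - \<epsilon>" by (simp add: algebra_simps)
  then have "\<eta>\<^sup>2 < (1 - \<epsilon>) / (1 + \<epsilon>)" using assms by (simp add: field_simps)
  then have "\<eta> < sqrt ((1 - \<epsilon>) / (1 + \<epsilon>))" by (rule real_less_rsqrt)
  then have "\<eta> < sqrt (1 - \<epsilon>) / sqrt (1 + \<epsilon>)" by (simp add: real_sqrt_divide)
  with le show "64 / 5 * sqrt (m * n * u + n * (n + 1) * u) + 1 / 10 < sqrt (1 - \<epsilon>) / sqrt (1 + \<epsilon>)"
    "105 / 1000 < sqrt (1 - \<epsilon>) / sqrt (1 + \<epsilon>)" by linarith+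
qed

text \<open>Compares the constants of the analysis with the stated bound. The square roots are at
  least 1, so the brackets are at least 4.05 / a and 2.73 / a, and \<open>kcoef\<close> is at least
  1.39 b. Both 1.14 * 1.21 * 3.181 < 4.05 * 1.39 and 1.14 * 1.21 * 2.161 < 2.73 * 1.39 hold.\<close>

lemma Delta_res_lower:
  fixes X :: "real^'n^'m" and u \<epsilon> :: real
  defines "n \<equiv> real CARD('n)" and "a \<equiv> sqrt (1 - \<epsilon>)" and "b \<equiv> sqrt (1 + \<epsilon>)"
  assumes eps: "0 \<le> \<epsilon>" "\<epsilon> < 1" "105 / 1000 < a / b" and u: "0 \<le> u"
  shows "114 / 100 * b * ((121 / 100) / a) * ((3181 / 1000) * (n * sqrt n * u * norm X)
           + (2161 / 1000) * (n\<^sup>2 * u * spectral_norm X)) \<le> Delta_res u \<epsilon> X"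
proof -
  define x where "x = sqrt (1 + 103 / 100 * (jcoef \<epsilon>)\<^sup>2)"
  define y where "y = sqrt (1 + 6 * (jcoef \<epsilon>)\<^sup>2) * (1 + 103 / 100 * (jcoef \<epsilon>)\<^sup>2)"
  have n: "0 \<le> n" by (simp add: n_def)
  have ab: "0 < a" "0 < b" "a \<le> b" using eps by (simp_all add: a_def b_def)
  have x: "1 \<le> x" by (simp add: x_def)
  have "1 * 1 \<le> y" unfolding y_def by (intro mult_mono) auto
  then have y: "1 \<le> y" by simp
  have k: "139 / 100 * b \<le> kcoef \<epsilon>"
  proof -
    \<comment> \<open>0.105 = 0.084 / 0.8 is exactly the threshold on a/b that makes the denominator
      of \<open>kcoef\<close> positive. As a <= b, that denominator is at most (0.8 - 0.084) /
      b.\<close>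
    have "(84 / 1000) / a < (8 / 10) / b" using eps ab by (simp add: field_simps)
    moreover have "(84 / 1000) / b \<le> (84 / 1000) / a" using ab by (intro divide_left_mono) auto
    then have "(8 / 10) / b - (84 / 1000) / a \<le> (716 / 1000) / b" by (simp add: field_simps)
    ultimately have "1 / ((716 / 1000) / b) \<le> 1 / ((8 / 10) / b - (84 / 1000) / a)"
      by (intro divide_left_mono) (use ab in auto)
    moreover have "139 / 100 * b \<le> 1 / ((716 / 1000) / b)" using ab by (simp add: field_simps)
    moreover have "kcoef \<epsilon> = 1 / ((8 / 10) / b - (84 / 1000) / a)"
      by (simp add: kcoef_def a_def b_def)
    ultimately show ?thesis by linarith
  qed
  have k0: "0 \<le> kcoef \<epsilon>" using k ab by (meson less_eq_real_def mult_nonneg_nonneg order_trans divide_nonneg_nonneg zero_le_numeral)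
  have comb: "p * (b / a) \<le> (q / a) * kcoef \<epsilon>" if "p \<le> q * (139 / 100)" "0 \<le> q" for p q
  proof -
    have "p * (b / a) \<le> q * (139 / 100) * (b / a)" using that ab by (intro mult_right_mono) auto
    also have "\<dots> = (q / a) * ((139 / 100) * b)" by simp
    also have "\<dots> \<le> (q / a) * kcoef \<epsilon>" using k that ab by (intro mult_left_mono) auto
    finally show ?thesis .
  qed
  have F: "114 / 100 * (121 / 100) * (3181 / 1000) * (b / a) \<le> ((131 / 100 + 137 / 100 * x + 137 / 100 * y) / a) * kcoef \<epsilon>"
    by (rule comb) (use x y in auto)
  have S: "114 / 100 * (121 / 100) * (2161 / 1000) * (b / a) \<le> ((136 / 100 * x + 137 / 100 * y) / a) * kcoef \<epsilon>"
    by (rule comb) (use x y in auto)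
  have "0 \<le> n * sqrt n * u * norm X" "0 \<le> n\<^sup>2 * u * spectral_norm X"
    using n u by (simp_all add: spectral_norm_nonneg)
  from add_mono[OF mult_right_mono[OF F this(1)] mult_right_mono[OF S this(2)]]
  have "114 / 100 * b * ((121 / 100) / a) * ((3181 / 1000) * (n * sqrt n * u * norm X)
           + (2161 / 1000) * (n\<^sup>2 * u * spectral_norm X))
      \<le> ((131 / 100 + 137 / 100 * x + 137 / 100 * y) / a) * kcoef \<epsilon> * (n * sqrt n * u * norm X)
        + ((136 / 100 * x + 137 / 100 * y) / a) * kcoef \<epsilon> * (n\<^sup>2 * u * spectral_norm X)"
    by (simp add: algebra_simps)
  also have "\<dots> = Delta_res u \<epsilon> X"
    unfolding Delta_res_def Let_def x_def y_def a_def n_def by (simp add: add_divide_distrib mult.assoc)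
  finally show ?thesis .
qed

text \<open>The deterministic core, for one sketch that embeds the range of \<open>Lh\<close>; the
  theorem then only has to supply the probability of such a sketch.\<close>

lemma rclupp_error_bounds:
  fixes X Lh Qh :: "real^'n::{finite,linorder}^'m::{finite,linorder}"
    and Uh Rh :: "real^'n::{finite,linorder}^'n::{finite,linorder}"
    and P :: "real^'m::{finite,linorder}^'m::{finite,linorder}" and Om :: "real^'m::{finite,linorder}^'s" and u c \<epsilon> :: real
  defines "m \<equiv> real CARD('m)" and "n \<equiv> real CARD('n)" and "s \<equiv> real CARD('s)"
  assumes embed: "subspace_embedding \<epsilon> Om (range ((*v) Lh))"
    and constants: "0 < u" "0 < c"
    and gamma: "\<forall>k \<in> {m, n, n + 1, c * s * n}. gam u k \<le> 1.02 * k * u"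
    and eps: "0 \<le> \<epsilon>" "\<epsilon> < 1" "\<epsilon> < (1 - (eta u m n)\<^sup>2) / (1 + (eta u m n)\<^sup>2)"
    and restr: "cond_restrictions u c \<epsilon> Lh Uh Om"
    and lu: "lu_computed u X P Lh Uh"
    and computed: "rclupp_computed u c X Lh Uh Om Qh Rh"
  shows "norm (transpose Qh ** Qh - mat 1) \<le> 6 * (m * n * u + n * (n + 1) * u)"
    and "norm (Qh ** Rh - X) \<le> Delta_res u \<epsilon> X"
proof -
  obtain Ls H Y0 Y1 W G1 Y2 V Y3 G2 Y4 where run:
    "product_computed u Om Lh Ls" "householder_qr_computed u c Ls H Y0" "product_computed u Y0 Uh Y1"
    "row_solve_computed u Y1 X W" "product_computed u (transpose W) W G1" "cholesky_computed u G1 Y2"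
    "row_solve_computed u Y2 W V" "product_computed u Y2 Y1 Y3" "product_computed u (transpose V) V G2"
    "cholesky_computed u G2 Y4" "row_solve_computed u Y4 V Qh" "product_computed u Y4 Y3 Rh"
    using computed unfolding rclupp_computed_def by blast
  define a where "a = sqrt (1 - \<epsilon>)"
  define b where "b = sqrt (1 + \<epsilon>)"
  define l where "l = singular_value CARD('n) Lh"
  define k where "k = singular_value CARD('n) Uh"
  have ab: "0 < a" "a \<le> b" "0 < b" using eps by (simp_all add: a_def b_def)
  have u: "0 \<le> u" "0 \<le> c" using constants by simp_all
  have gm: "gam u m \<le> 51 / 50 * m * u" and gn: "gam u n \<le> 51 / 50 * n * u"
    and gn1: "gam u (n + 1) \<le> 51 / 50 * (n + 1) * u"
    and gc: "gam u (c * s * n) \<le> 51 / 50 * (c * s * n) * u"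
    using gamma by simp_all
  note restr' = cond_restrictions_bounds[OF restr constants eps(1,2), folded a_def b_def l_def k_def]
  have low: "l * norm v \<le> norm (Lh *v v)" "k * norm v \<le> norm (Uh *v v)" for v
    unfolding l_def k_def by (rule singular_value_CARD_bound)+
  have emb: "a * norm (Lh *v v) \<le> norm (Om *v (Lh *v v))" "norm (Om *v (Lh *v v)) \<le> b * norm (Lh *v v)" for v
    unfolding a_def b_def by (rule subspace_embedding_bounds[OF embed _ eps(1,2)]; simp)+
  note Y0 = sketched_qr_bounds[OF emb ab(1,2) run(1,2) u gm[unfolded m_def]
      gc[unfolded s_def n_def] low(1) restr'(3)]
  note Y1 = preconditioner_bounds[OF Y0 ab(1,2) run(3) u(1) gn[unfolded n_def] low less_imp_le[OF restr'(1)] restr'(4)]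
  note X = lu_bounds[OF lu ab(1,2) u(1) gn[unfolded n_def] low less_imp_le[OF restr'(1)] less_imp_le[OF restr'(2)] restr'(4)]
  obtain D where D: "W ** Y1 = X + D" "norm D \<le> 51 / 50 * n * u * (norm W * norm Y1)"
    and YX: "\<And>v. norm (Y1 *v v) \<le> 114 / 100 * b * norm (X *v v)"
    and W: "spectral_norm W \<le> (121 / 100) / a"
      "\<And>w. ((877 / 1000) / b - (63 / 1000) / a) * norm w \<le> norm (W *v w)"
    using preconditioned_bounds[OF Y1 X run(4) ab(1,2) u(1) gn[unfolded n_def] low restr'(1,2,4)]
    unfolding n_def by blast

  define \<delta> where "\<delta> = m * n * u + n * (n + 1) * u"
  have \<delta>0: "0 \<le> \<delta>" using u by (simp add: \<delta>_def m_def n_def)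
  note \<eta> = eta_bounds[OF eps, folded a_def b_def \<delta>_def]
  define h where "h = (121 / 100) / a"
  define r where "r = (877 / 1000) / b - (63 / 1000) / a"
  \<comment> \<open>Positivity of \<open>r\<close> amounts to a/b > 0.063 / 0.877, which is below
    0.105.\<close>
  have "105 / 1000 * b < a" using \<eta>(2) ab by (simp add: field_simps)
  then have r: "0 < r" unfolding r_def using ab by (simp add: field_simps)
  \<comment> \<open>Dividing the bound on \<eta> by \<open>a\<close> makes it comparable with
    \<open>r\<close>. Since 9 * 1.21 / 12.8 lies between 0.63 and 0.877, sqrt \<delta> times
    \<open>h / r\<close> is at most 1/9, and 1/81 < 1/80.\<close>
  have "sqrt \<delta> * (64 / 5) / a < (a / b - 1 / 10) / a"
    using \<eta>(1) ab by (intro divide_strict_right_mono) auto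
  then have "64 / 5 * (sqrt \<delta> / a) \<le> 1 / b - (1 / 10) / a"
    using ab by (simp add: diff_divide_distrib)
  moreover have "(1 / 10) / a = 1 / 10 * (1 / a)" by simp
  moreover have "9 * (sqrt \<delta> * h) = 1089 / 100 * (sqrt \<delta> / a)" by (simp add: h_def)
  moreover have "r = 877 / 1000 * (1 / b) - (63 / 1000) * (1 / a)" by (simp add: r_def)
  moreover have "0 < 1 / a" "0 < 1 / b" using ab by simp_all
  ultimately have "9 * (sqrt \<delta> * h) \<le> r" by linarith
  then have "sqrt \<delta> * (h / r) \<le> 1 / 9" using r by (simp add: field_simps)
  then have "(sqrt \<delta> * (h / r))\<^sup>2 \<le> (1 / 9)\<^sup>2"
    using \<delta>0 r ab by (intro power_mono) (auto simp: h_def)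
  moreover have "(sqrt \<delta> * (h / r))\<^sup>2 = \<delta> * (h / r)\<^sup>2"
    unfolding power_mult_distrib using \<delta>0 by simp
  moreover have "(1 / 9 :: real)\<^sup>2 \<le> 1 / 80" by (simp add: power2_eq_square)
  ultimately have small: "\<delta> * (h / r)\<^sup>2 \<le> 1 / 80" by linarith
  have "a / b \<le> 1" using ab by simp
  with \<eta>(1) have "sqrt \<delta> \<le> 1 / 10" by linarith
  then have "(sqrt \<delta>)\<^sup>2 \<le> (1 / 10)\<^sup>2" using \<delta>0 by (intro power_mono) auto
  then have small': "\<delta> \<le> 1 / 100" using \<delta>0 by (simp add: power2_eq_square[of "1 / 10"])
  note final = cholesky_qr2_bounds[OF D[unfolded n_def] YX _ run(5,6,7,8,9,10,11,12) u(1)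
      gm[unfolded m_def] gn[unfolded n_def] gn1[unfolded n_def] W[folded h_def r_def] r
      small[unfolded \<delta>_def m_def n_def] small'[unfolded \<delta>_def m_def n_def]]
  show "norm (transpose Qh ** Qh - mat 1) \<le> 6 * (m * n * u + n * (n + 1) * u)"
    using final(1) ab by (simp add: m_def n_def)
  have "norm (Qh ** Rh - X) \<le> 114 / 100 * b * h * ((3181 / 1000) * (n * sqrt n * u * norm X)
           + (2161 / 1000) * (n\<^sup>2 * u * spectral_norm X))"
    unfolding n_def by (rule final(2)) (use ab in simp)
  also have "\<dots> \<le> Delta_res u \<epsilon> X"
    using Delta_res_lower[OF eps(1,2) \<eta>(2)[unfolded a_def b_def] u(1), of X]
    by (simp add: h_def a_def b_def n_def)
  finally show "norm (Qh ** Rh - X) \<le> Delta_res u \<epsilon> X" .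
qed

section \<open>From one sketch to the random sketch\<close>

lemma dim_range_injective:
  fixes L :: "real^'n^'m"
  assumes "\<And>v. l * norm v \<le> norm (L *v v)" "0 < l"
  shows "dim (range ((*v) L)) = CARD('n)"
proof -
  have "inj ((*v) L)"
  proof (rule injI)
    fix v w assume "L *v v = L *v w"
    then have "l * norm (v - w) \<le> 0"
      using assms(1)[of "v - w"] by (simp add: matrix_vector_mult_diff_distrib)
    then show "v = w" using \<open>0 < l\<close> by (simp add: mult_le_0_iff)
  qed
  then have "dim (range ((*v) L)) = dim (UNIV :: (real^'n) set)"
    by (intro dim_image_eq) auto
  then show ?thesis by simp
qed

theorem theorem3p4:
  fixes M :: "'w measure"
    and X :: "real^'n::{finite,linorder}^'m::{finite,linorder}"
    and P :: "real^'m::{finite,linorder}^'m::{finite,linorder}" and Lh :: "real^'n::{finite,linorder}^'m::{finite,linorder}" and Uh :: "real^'n::{finite,linorder}^'n::{finite,linorder}"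
    and Om :: "'w \<Rightarrow> real^'m::{finite,linorder}^'s::finite"
    and Qh :: "'w \<Rightarrow> real^'n::{finite,linorder}^'m::{finite,linorder}" and Rh :: "'w \<Rightarrow> real^'n::{finite,linorder}^'n::{finite,linorder}"
    and u c \<epsilon> p :: real and m n s :: nat
  assumes dims: "m = CARD('m)" "n = CARD('n)" "s = CARD('s)" "n < m" "n \<le> s" "s \<le> m"
    and full_rank: "rank X = n"
    and constants: "0 < u" "0 < c" "0 \<le> p" "p \<le> 1"
    and gamma: "\<forall>k \<in> {real m, real n, real n + 1, c * real s * real n}. gam u k \<le> 1.02 * k * u"
    and prob: "prob_space M"
    and Om_random: "Om \<in> borel_measurable M"
    and Om_ose: "oblivious_embedding M Om \<epsilon> p n"
    and eps: "0 \<le> \<epsilon>" "\<epsilon> < 1"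
      "\<epsilon> < (1 - (eta u (real m) (real n))\<^sup>2) / (1 + (eta u (real m) (real n))\<^sup>2)"
    and eta: "eta u (real m) (real n) < 1"
    and size1: "real m * sqrt (real s) * u \<le> 1 / 64"
    and size2: "max c 1 * real s * real n * sqrt (real n) * u \<le> 1 / 64"
    and size34: "AE \<omega> in M. cond_restrictions u c \<epsilon> Lh Uh (Om \<omega>)"
    and lu: "lu_computed u X P Lh Uh"
    and computed: "AE \<omega> in M. rclupp_computed u c X Lh Uh (Om \<omega>) (Qh \<omega>) (Rh \<omega>)"
  shows "\<exists>E \<in> sets M. (1 - p)\<^sup>2 \<le> measure M E \<and>
    (\<forall>\<omega> \<in> E.
       frobenius_norm (transpose (Qh \<omega>) ** Qh \<omega> - mat 1)
         \<le> 6 * (real m * real n * u + real n * (real n + 1) * u) \<and>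
       frobenius_norm (Qh \<omega> ** Rh \<omega> - X) \<le> Delta_res u \<epsilon> X)"
proof (cases "p = 1")
  case True
  \<comment> \<open>The required probability is 0 here. In the other case 1 - p > 0, on which the
    measurability of \<open>S\<close> depends.\<close>
  then show ?thesis by (intro bexI[of _ "{}"]) auto
next
  case False
  interpret prob_space M by (rule prob)
  \<comment> \<open>\<open>Lh\<close> does not depend on \<omega>, so its range is one fixed
    subspace, as obliviousness demands.\<close>
  define S where "S = {\<omega> \<in> space M. subspace_embedding \<epsilon> (Om \<omega>) (range ((*v) Lh))}"
  let ?ok = "\<lambda>\<omega>. cond_restrictions u c \<epsilon> Lh Uh (Om \<omega>) \<and> rclupp_computed u c X Lh Uh (Om \<omega>) (Qh \<omega>) (Rh \<omega>)"
  have ok: "AE \<omega> in M. ?ok \<omega>" using size34 computed by eventually_elim simp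
  then obtain N where N: "{\<omega> \<in> space M. \<not> ?ok \<omega>} \<subseteq> N" "emeasure M N = 0" "N \<in> sets M"
    by (rule AE_E)
  then have null: "N \<in> null_sets M" by blast
  \<comment> \<open>A single good outcome suffices, because the smallest singular value of
    \<open>Lh\<close> is deterministic. Its positivity gives the range dimension exactly n, the
    dimension for which the embedding property is stated.\<close>
  have "\<exists>\<omega>. ?ok \<omega>"
    using ok by (rule eventually_happens'[OF ae_filter_bot])
  then have "0 < singular_value CARD('n) Lh"
    using cond_restrictions_bounds(1)[OF _ constants(1,2) eps(1,2)] by blast
  then have "dim (range ((*v) Lh)) = n"
    using dim_range_injective[OF singular_value_CARD_bound(2)[of Lh]] dims by simp
  moreover have "subspace (range ((*v) Lh))"
    by (intro linear_subspace_image matrix_vector_mul_linear subspace_UNIV)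
  ultimately have S: "1 - p \<le> measure M S"
    using Om_ose unfolding oblivious_embedding_def S_def by blast
  \<comment> \<open>\<open>measure\<close> takes the value 0 off \<open>sets M\<close>, so the
    positive lower bound makes \<open>S\<close> measurable.\<close>
  then have "S \<in> sets M" using False constants measure_notin_sets[of S M] by fastforce
  show ?thesis
  proof (intro bexI conjI ballI)
    show "S - N \<in> sets M" using \<open>S \<in> sets M\<close> N by auto
    \<comment> \<open>Only one subspace has to be embedded, so a single event of probability at
      least 1 - p suffices; removing the null set \<open>N\<close> leaves its probability
      unchanged.\<close>
    have "(1 - p)\<^sup>2 \<le> 1 - p" using constants by (simp add: power2_eq_square mult_left_le)
    also have "\<dots> \<le> measure M (S - N)"
      using S measure_Diff_null_set[OF \<open>S \<in> sets M\<close> null] by simp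
    finally show "(1 - p)\<^sup>2 \<le> measure M (S - N)" .
    fix \<omega> assume \<omega>: "\<omega> \<in> S - N"
    then have "?ok \<omega>" "subspace_embedding \<epsilon> (Om \<omega>) (range ((*v) Lh))"
      using N(1) by (auto simp: S_def)
    note bounds = rclupp_error_bounds[OF this(2) constants(1,2) gamma[unfolded dims(1-3)]
        eps[unfolded dims(1-3)] conjunct1[OF this(1)] lu conjunct2[OF this(1)]]
    show "norm (transpose (Qh \<omega>) ** Qh \<omega> - mat 1)
        \<le> 6 * (real m * real n * u + real n * (real n + 1) * u)"
      using bounds(1) by (simp add: dims(1-3))
    show "norm (Qh \<omega> ** Rh \<omega> - X) \<le> Delta_res u \<epsilon> X"
      by (rule bounds(2))
  qed
qed

end
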